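(* Let $E\subseteq\mathbb R$ be a closed set of Lebesgue measure zero. Suppose that $E$ has property $\mathrm{LP}(p)$ for some $p$ with $1<p<\infty$, $p\neq 2$. Then $E$ is porous.
   Context: Property $\mathrm{LP}(p)$. Let $E\subseteq\mathbb R$ be a closed set of Lebesgue measure zero, and let $I_k$, $k=1,2,\ldots$, be the intervals complementary to $E$, i.e. the (finitely or countably many) connected components of $\mathbb R\setminus E$ (unbounded components included). Let $S_k$ be the operator defined by $\widehat{S_kf}=1_{I_k}\cdot\widehat f$ for $f\in L^2\cap L^p(\mathbb R)$, where $1_{I_k}$ is the characteristic function of $I_k$ and $\widehat{\ }$ is the Fourier transform (extended to $L^p(\mathbb R)$ by density). Put $S(f)=\left(\sum_k|S_kf|^2\right)^{1/2}$. For $1<p<\infty$, the set $E$ has property $\mathrm{LP}(p)$ if there are positive constants $c_1,c_2$ independent of $f$ such that $c_1\|f\|_{L^p(\mathbb R)}\le\|S(f)\|_{L^p(\mathbb R)}\le c_2\|f\|_{L^p(\mathbb R)}$ for all $f\in L^p(\mathbb R)$. Porosity. A set $F\subseteq\mathbb R$ is porous if there exists a constant $c>0$ such that every bounded interval $I\subseteq\mathbb R$ of positive length contains a subinterval $J$ with $|J|\ge c|I|$ and $J\cap F=\varnothing$. Here $|\cdot|$ denotes length (Lebesgue measure). *)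

theory Defs
  imports "HOL-Analysis.Analysis"
begin

text \<open>Real powers of extended nonnegative reals; only used with exponents \<open>a > 0\<close>,
  for which \<open>0\<close> is sent to \<open>0\<close>.\<close>

definition enn_powr :: "ennreal \<Rightarrow> real \<Rightarrow> ennreal" where
  "enn_powr x a = (if x = \<infinity> then \<infinity> else ennreal (enn2real x powr a))"

definition enn_Lp_norm :: "real \<Rightarrow> (real \<Rightarrow> ennreal) \<Rightarrow> ennreal" where
  "enn_Lp_norm p g = enn_powr (\<integral>\<^sup>+x. enn_powr (g x) p \<partial>lborel) (1 / p)"

definition Lp_norm :: "real \<Rightarrow> (real \<Rightarrow> complex) \<Rightarrow> ennreal" where
  "Lp_norm p f = enn_Lp_norm p (\<lambda>x. ennreal (cmod (f x)))"

text \<open>Functions are not identified when they agree almost everywhere; every class in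
  \<open>L\<^sup>p(\<real>)\<close> has a Borel representative.\<close>

definition Lp :: "real \<Rightarrow> (real \<Rightarrow> complex) set" where
  "Lp p = {f \<in> borel_measurable lborel. Lp_norm p f < \<infinity>}"

definition Lp_tendsto :: "real \<Rightarrow> (nat \<Rightarrow> real \<Rightarrow> complex) \<Rightarrow> (real \<Rightarrow> complex) \<Rightarrow> bool" where
  "Lp_tendsto p u f \<longleftrightarrow> (\<lambda>n. Lp_norm p (\<lambda>x. u n x - f x)) \<longlonglongrightarrow> 0"

text \<open>The Fourier integral, meaningful on \<open>L\<^sup>1(\<real>)\<close>.\<close>

definition fourier_integral :: "(real \<Rightarrow> complex) \<Rightarrow> real \<Rightarrow> complex" where
  "fourier_integral f \<xi> = (LINT x|lborel. cis (- (2 * pi * \<xi> * x)) * f x)"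

text \<open>\<open>g\<close> is (a representative of) the Fourier transform of \<open>f \<in> L\<^sup>2(\<real>)\<close>, obtained from
  the Fourier integral on \<open>L\<^sup>1 \<inter> L\<^sup>2\<close> by density.\<close>

definition is_fourier :: "(real \<Rightarrow> complex) \<Rightarrow> (real \<Rightarrow> complex) \<Rightarrow> bool" where
  "is_fourier f g \<longleftrightarrow> f \<in> Lp 2 \<and> g \<in> Lp 2 \<and>
    (\<exists>u. (\<forall>n. u n \<in> Lp 1 \<inter> Lp 2) \<and> Lp_tendsto 2 u f \<and>
         Lp_tendsto 2 (\<lambda>n. fourier_integral (u n)) g)"

text \<open>\<open>h\<close> is (a representative of) the function with Fourier transform
  \<open>1\<^sub>I\<close> times the Fourier transform of \<open>f \<in> L\<^sup>2(\<real>)\<close>.\<close>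

definition is_freq_restr_L2 :: "real set \<Rightarrow> (real \<Rightarrow> complex) \<Rightarrow> (real \<Rightarrow> complex) \<Rightarrow> bool" where
  "is_freq_restr_L2 I f h \<longleftrightarrow>
    (\<exists>g. is_fourier f g \<and> is_fourier h (\<lambda>\<xi>. indicator I \<xi> * g \<xi>))"

text \<open>The extension by density of the above operator from \<open>L\<^sup>2 \<inter> L\<^sup>p\<close> to \<open>L\<^sup>p(\<real>)\<close>.
  For an interval \<open>I\<close> and \<open>1 < p < \<infinity>\<close> the operator is bounded in \<open>L\<^sup>p\<close> norm (M. Riesz), so
  \<open>h\<close> exists and is unique up to null sets.\<close>

definition is_freq_restr ::
    "real \<Rightarrow> real set \<Rightarrow> (real \<Rightarrow> complex) \<Rightarrow> (real \<Rightarrow> complex) \<Rightarrow> bool" where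
  "is_freq_restr p I f h \<longleftrightarrow> f \<in> Lp p \<and> h \<in> Lp p \<and>
    (\<exists>u v. (\<forall>n. u n \<in> Lp 2 \<inter> Lp p \<and> is_freq_restr_L2 I (u n) (v n)) \<and>
           Lp_tendsto p u f \<and> Lp_tendsto p v h)"

text \<open>The square function of a family indexed by the complementary intervals of \<open>E\<close>.\<close>

definition square_fun :: "real set \<Rightarrow> (real set \<Rightarrow> real \<Rightarrow> complex) \<Rightarrow> real \<Rightarrow> ennreal" where
  "square_fun E h x =
    enn_powr (\<Sum>\<^sub>\<infinity>I\<in>components (- E). ennreal ((cmod (h I x))\<^sup>2)) (1 / 2)"

text \<open>In \<open>LP_property\<close>, \<open>h I\<close> is the image of \<open>f\<close> under the operator belonging to the
  complementary interval \<open>I\<close>; quantifying over all such \<open>h\<close> only quantifies over the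
  choice of representatives.\<close>

definition LP_property :: "real \<Rightarrow> real set \<Rightarrow> bool" where
  "LP_property p E \<longleftrightarrow>
    (\<exists>c1 c2 :: real. c1 > 0 \<and> c2 > 0 \<and>
      (\<forall>f \<in> Lp p. \<forall>h. (\<forall>I \<in> components (- E). is_freq_restr p I f (h I)) \<longrightarrow>
        ennreal c1 * Lp_norm p f \<le> enn_Lp_norm p (square_fun E h) \<and>
        enn_Lp_norm p (square_fun E h) \<le> ennreal c2 * Lp_norm p f))"

definition porous :: "real set \<Rightarrow> bool" where
  "porous F \<longleftrightarrow>
    (\<exists>c > 0. \<forall>I. is_interval I \<and> bounded I \<and> measure lborel I > 0 \<longrightarrow>
      (\<exists>J \<subseteq> I. is_interval J \<and> measure lborel J \<ge> c * measure lborel I \<and> J \<inter> F = {}))"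

end

theory Submission
  imports Defs "HOL-Probability.Probability"
begin

text \<open>Flipping the sign of \<open>S\<^sub>k f\<close> for some of the complementary intervals does not change the
  square function, so \<open>LP(p)\<close> bounds all multipliers that equal \<open>\<plusminus>1\<close> on each of these intervals,
  uniformly in \<open>L\<^sup>p\<close>. If \<open>E\<close> is not porous, there are intervals that, when cut into \<open>N\<close> equal
  cells, have every cell filled up to an arbitrarily small proportion by complementary intervals.
  In the limit, all sign multipliers that are constant on \<open>N\<close> consecutive unit cells are bounded
  uniformly in \<open>N\<close>. With \<open>\<psi>\<close> the inverse transform of \<open>1\<^bsub>(0,1)\<^esub>\<close>, this means
  \<open>\<parallel>\<psi> \<Sum> e\<^sub>j a\<^sub>j z\<^sup>j\<parallel>\<^sub>p \<le> C \<parallel>\<psi> \<Sum> a\<^sub>j z\<^sup>j\<parallel>\<^sub>p\<close> for all signs \<open>e\<^sub>j\<close> and unimodular \<open>a\<^sub>j\<close>.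
  But \<open>\<psi>\<close> times the Dirichlet kernel is a dilate of \<open>\<psi>\<close>, with norm of order \<open>N\<^bsup>1-1/p\<^esup>\<close>,
  while a Rudin-Shapiro pair, for which \<open>\<bar>P\<bar>\<^sup>2 + \<bar>Q\<bar>\<^sup>2 = 2N\<close> everywhere, gives norms of order
  at most \<open>N\<^bsup>1/2\<^esup>\<close>, attained by \<open>P\<close> or \<open>Q\<close> if \<open>p < 2\<close>.\<close>

section \<open>L^p integrals and powers of extended nonnegative reals\<close>

definition Lp_integral :: "real \<Rightarrow> (real \<Rightarrow> complex) \<Rightarrow> ennreal" where
  "Lp_integral p f = (\<integral>\<^sup>+x. ennreal (cmod (f x) powr p) \<partial>lborel)"

lemma enn_powr_ennreal: "0 \<le> a \<Longrightarrow> enn_powr (ennreal a) p = ennreal (a powr p)"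
  by (simp add: enn_powr_def)

lemma enn_powr_less_top_iff: "enn_powr x a < \<infinity> \<longleftrightarrow> x < \<infinity>"
  by (auto simp: enn_powr_def less_top[symmetric])

text \<open>The root is split off here once. Estimates are then made for \<open>Lp_integral\<close>,
  to which scaling, domination and Fatou apply directly.\<close>

lemma Lp_norm_eq: "Lp_norm p f = enn_powr (Lp_integral p f) (1 / p)"
  by (simp add: Lp_norm_def enn_Lp_norm_def Lp_integral_def enn_powr_ennreal)

lemma mem_Lp_iff: "f \<in> Lp p \<longleftrightarrow> f \<in> borel_measurable borel \<and> Lp_integral p f < \<infinity>"
  by (simp add: Lp_def Lp_norm_eq enn_powr_less_top_iff[unfolded infinity_ennreal_def])

lemma tendsto_enn_powr_0:
  assumes "0 < a" "X \<longlonglongrightarrow> 0"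
  shows "(\<lambda>n. enn_powr (X n) a) \<longlonglongrightarrow> 0"
proof -
  \<comment> \<open>From some index on \<open>X n\<close> is finite, so \<open>enn2real\<close>
    loses nothing and the branch of \<open>enn_powr\<close> at \<infinity> is avoided.\<close>
  have lt: "\<forall>\<^sub>F n in sequentially. X n < 1"
    using order_tendstoD(2)[OF assms(2), of 1] by simp
  have e2r: "(\<lambda>n. enn2real (X n)) \<longlonglongrightarrow> 0"
    using tendsto_enn2real[of X 0 sequentially] assms(2) by simp
  have "(\<lambda>n. ennreal (enn2real (X n) powr a)) \<longlonglongrightarrow> ennreal 0"
  proof (rule tendsto_ennrealI)
    show "(\<lambda>n. enn2real (X n) powr a) \<longlonglongrightarrow> 0"
      using assms(1) tendsto_powr'[OF e2r tendsto_const[of a]] by simp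
  qed
  moreover have "\<forall>\<^sub>F n in sequentially. ennreal (enn2real (X n) powr a) = enn_powr (X n) a"
    using lt by (rule eventually_mono) (auto simp: enn_powr_def)
  ultimately show ?thesis
    using Lim_transform_eventually by fastforce
qed

lemma Lp_tendstoI:
  assumes "0 < p" "(\<lambda>n. Lp_integral p (\<lambda>x. u n x - f x)) \<longlonglongrightarrow> 0"
  shows "Lp_tendsto p u f"
  unfolding Lp_tendsto_def Lp_norm_eq by (rule tendsto_enn_powr_0) (use assms in auto)

lemma Lp_tendsto_const: "0 < p \<Longrightarrow> Lp_tendsto p (\<lambda>_. f) f"
  by (rule Lp_tendstoI) (simp_all add: Lp_integral_def)

lemma Lp_integral_2: "Lp_integral 2 f = (\<integral>\<^sup>+x. ennreal ((cmod (f x))\<^sup>2) \<partial>lborel)"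
  by (simp add: Lp_integral_def flip: powr_numeral)

lemma Lp_integral_1: "Lp_integral 1 f = (\<integral>\<^sup>+x. ennreal (cmod (f x)) \<partial>lborel)"
  by (simp add: Lp_integral_def)

lemma Lp_integral_mono:
  assumes "0 \<le> p" "\<And>x. cmod (f x) \<le> cmod (g x)"
  shows "Lp_integral p f \<le> Lp_integral p g"
  unfolding Lp_integral_def
  by (intro nn_integral_mono ennreal_leI powr_mono2) (use assms in auto)

lemma Lp_integral_cmult:
  assumes [measurable]: "f \<in> borel_measurable borel"
  shows "Lp_integral p (\<lambda>x. c * f x) = ennreal (cmod c powr p) * Lp_integral p f"
  unfolding Lp_integral_def
  by (simp add: norm_mult powr_mult ennreal_mult'' nn_integral_cmult)

lemma Lp_integral_scale:
  assumes [measurable]: "f \<in> borel_measurable borel" and "0 < c"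
  shows "Lp_integral p f = ennreal c * Lp_integral p (\<lambda>x. f (c * x))"
  unfolding Lp_integral_def
  by (subst nn_integral_real_affine[where c=c and t=0]) (use assms in auto)

text \<open>With both integrals finite, the inequality is one between reals, which can be divided by
  c1 and raised to the power p.\<close>

lemma Lp_integral_le_of_Lp_norm_le:
  assumes p: "0 < p" and c: "0 < c1" "0 < c2"
    and le: "ennreal c1 * Lp_norm p f \<le> ennreal c2 * Lp_norm p g"
    and fin: "Lp_integral p f < \<infinity>" "Lp_integral p g < \<infinity>"
  shows "Lp_integral p f \<le> ennreal ((c2 / c1) powr p) * Lp_integral p g"
proof -
  obtain a where a: "Lp_integral p f = ennreal a" "0 \<le> a"
    using fin(1) by (cases "Lp_integral p f") auto
  obtain b where b: "Lp_integral p g = ennreal b" "0 \<le> b"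
    using fin(2) by (cases "Lp_integral p g") auto
  have "ennreal (c1 * a powr (1/p)) \<le> ennreal (c2 * b powr (1/p))"
    using le a b c by (simp add: Lp_norm_eq enn_powr_ennreal ennreal_mult)
  then have "c1 * a powr (1/p) \<le> c2 * b powr (1/p)"
    using c by (simp add: ennreal_le_iff)
  then have "a powr (1/p) \<le> (c2 / c1) * b powr (1/p)"
    using c by (simp add: field_simps)
  then have "(a powr (1/p)) powr p \<le> ((c2 / c1) * b powr (1/p)) powr p"
    using p by (intro powr_mono2) auto
  also have "\<dots> = (c2 / c1) powr p * b"
    using p b c by (subst powr_mult) (auto simp: powr_powr)
  finally have "a \<le> (c2 / c1) powr p * b"
    using p a by (simp add: powr_powr)
  then show ?thesis
    unfolding a b using c b by (simp flip: ennreal_mult)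
qed

text \<open>On the half-line the antiderivative -(1 + x)^(1 - p) / (p - 1) tends to 0 at infinity
  because p > 1; reflection handles the negative half-line.\<close>

lemma nn_integral_inverse_powr_less_top:
  fixes p :: real
  assumes "1 < p"
  shows "(\<integral>\<^sup>+x. ennreal ((1 + \<bar>x\<bar>) powr - p) \<partial>lborel) < \<infinity>"
proof -
  let ?f = "\<lambda>x. ennreal ((1 + \<bar>x\<bar>) powr - p) * indicator {0..} x"
  have "(\<integral>\<^sup>+x. ?f x \<partial>lborel) = (\<integral>\<^sup>+x. ennreal (if 0 \<le> x then (1 + x) powr - p else 0) * indicator {0..} x \<partial>lborel)"
    by (intro nn_integral_cong) (auto split: split_indicator)
  also have "\<dots> = ennreal (0 - (- ((1 + 0) powr (1 - p) / (p - 1))))"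
  proof (rule nn_integral_FTC_atLeast[where F="\<lambda>x. - ((1 + x) powr (1 - p) / (p - 1))"])
    show "((\<lambda>x. - ((1 + x) powr (1 - p) / (p - 1))) has_real_derivative (if 0 \<le> x then (1 + x) powr - p else 0)) (at x)"
      if "0 \<le> x" for x
    proof -
      have "((\<lambda>x. - ((1 + x) powr (1 - p) / (p - 1))) has_real_derivative
          - (((1 - p) * (1 + x) powr (1 - p - 1) * 1) / (p - 1))) (at x)"
        using that DERIV_fun_powr[of "\<lambda>x. 1 + x" 1 x "1 - p"]
        by (intro DERIV_minus DERIV_cdivide) (auto intro!: derivative_eq_intros)
      also have "- (((1 - p) * (1 + x) powr (1 - p - 1) * 1) / (p - 1)) = (if 0 \<le> x then (1 + x) powr - p else 0)"
        using that assms by (simp add: field_simps)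
      finally show ?thesis .
    qed
    have "((\<lambda>x. (1 + x) powr (1 - p)) \<longlongrightarrow> 0) at_top"
      using assms by (intro tendsto_neg_powr filterlim_tendsto_add_at_top[OF tendsto_const] filterlim_ident) auto
    from tendsto_minus[OF tendsto_divide[OF this tendsto_const[of "p - 1"]]] assms
    show "((\<lambda>x. - ((1 + x) powr (1 - p) / (p - 1))) \<longlongrightarrow> 0) at_top"
      by simp
  qed auto
  finally have pos: "(\<integral>\<^sup>+x. ?f x \<partial>lborel) < \<infinity>"
    by simp
  have "(\<integral>\<^sup>+x. ennreal ((1 + \<bar>x\<bar>) powr - p) \<partial>lborel) \<le> (\<integral>\<^sup>+x. ?f x + ?f (0 + -1 * x) \<partial>lborel)"
    by (intro nn_integral_mono) (auto split: split_indicator)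
  also have "\<dots> = (\<integral>\<^sup>+x. ?f x \<partial>lborel) + (\<integral>\<^sup>+x. ?f (0 + -1 * x) \<partial>lborel)"
    by (intro nn_integral_add) auto
  also have "(\<integral>\<^sup>+x. ?f (0 + -1 * x) \<partial>lborel) = (\<integral>\<^sup>+x. ?f x \<partial>lborel)"
    by (subst nn_integral_real_affine[where c="-1" and t=0, of ?f]) auto
  finally show ?thesis
    by (rule le_less_trans) (use pos in \<open>simp add: less_top[symmetric]\<close>)
qed

text \<open>The rate 1 / (1 + |x|) is that of inverse transforms of interval indicators; it gives
  membership in every L^p with p > 1, though in general not in L^1.\<close>

lemma mem_Lp_of_decay:
  assumes "f \<in> borel_measurable borel" "1 < p" "\<And>x. cmod (f x) \<le> C / (1 + \<bar>x\<bar>)"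
  shows "f \<in> Lp p"
proof -
  have C: "0 \<le> C" using assms(3)[of 0] order_trans[OF norm_ge_zero] by fastforce
  have "Lp_integral p f \<le> (\<integral>\<^sup>+x. ennreal (C powr p) * ennreal ((1 + \<bar>x\<bar>) powr - p) \<partial>lborel)"
    unfolding Lp_integral_def
  proof (intro nn_integral_mono)
    fix x
    have "cmod (f x) powr p \<le> (C / (1 + \<bar>x\<bar>)) powr p"
      using assms by (intro powr_mono2) auto
    also have "\<dots> = C powr p * (1 + \<bar>x\<bar>) powr - p"
      using C by (simp add: powr_divide powr_minus_divide)
    finally show "ennreal (cmod (f x) powr p) \<le> ennreal (C powr p) * ennreal ((1 + \<bar>x\<bar>) powr - p)"
      by (simp flip: ennreal_mult)
  qed
  also have "\<dots> = ennreal (C powr p) * (\<integral>\<^sup>+x. ennreal ((1 + \<bar>x\<bar>) powr - p) \<partial>lborel)"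
    by (rule nn_integral_cmult) auto
  also have "\<dots> < \<infinity>"
    using nn_integral_inverse_powr_less_top[OF assms(2)] by (simp add: ennreal_mult_less_top)
  finally show ?thesis
    using assms(1) by (simp add: mem_Lp_iff)
qed

section \<open>Inverse Fourier integrals of step functions\<close>

text \<open>For step functions this is an absolutely convergent integral;
  \<open>is_fourier_inv_fourier\<close> relates it to the transform on L^2.\<close>

definition inv_fourier :: "(real \<Rightarrow> complex) \<Rightarrow> real \<Rightarrow> complex" where
  "inv_fourier g x = (LINT \<xi>|lborel. cis (2 * pi * x * \<xi>) * g \<xi>)"

text \<open>The test functions on the frequency side: closed under multiplication by indicators of
  intervals, with inverse transforms in every L^p, p > 1. Closure, decay and approximation all
  follow by the induction that this form provides.\<close>

inductive step_fun :: "(real \<Rightarrow> complex) \<Rightarrow> bool" where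
  zero: "step_fun (\<lambda>_. 0)"
| add_indicator: "step_fun g \<Longrightarrow> is_interval J \<Longrightarrow> bounded J \<Longrightarrow> step_fun (\<lambda>\<xi>. g \<xi> + c * indicator J \<xi>)"

text \<open>Whether the endpoints belong to J does not affect any integral, so this sandwich treats
  intervals of all types at once.\<close>

lemma bounded_interval_endpoints:
  fixes J :: "real set"
  assumes "is_interval J" "bounded J" "J \<noteq> {}"
  obtains a b where "a \<le> b" "{a<..<b} \<subseteq> J" "J \<subseteq> {a..b}"
proof
  have bdd: "bdd_above J" "bdd_below J"
    using assms(2) by (auto intro: bounded_imp_bdd_above bounded_imp_bdd_below)
  show "J \<subseteq> {Inf J..Sup J}"
    using bdd by (auto intro: cInf_lower cSup_upper)
  show "Inf J \<le> Sup J"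
    using bdd assms(3) by (intro cInf_le_cSup)
  show "{Inf J<..<Sup J} \<subseteq> J"
  proof
    fix x assume "x \<in> {Inf J<..<Sup J}"
    then obtain u v where "u \<in> J" "u < x" "v \<in> J" "x < v"
      using bdd assms(3) by (auto simp: cInf_less_iff less_cSup_iff)
    then show "x \<in> J"
      using assms(1) by (meson mem_is_interval_1_I less_imp_le)
  qed
qed

lemma integrable_indicator_bounded_interval:
  fixes J :: "real set"
  assumes "is_interval J" "bounded J"
  shows "integrable lborel (indicator J :: real \<Rightarrow> complex)"
proof -
  have "integrable lborel (\<lambda>x. complex_of_real (indicator J x))"
    using assms emeasure_bounded_finite[OF assms(2)]
    by (intro integrable_of_real integrable_real_indicator) (auto intro: real_interval_borel_measurable)
  also have "(\<lambda>x. complex_of_real (indicator J x)) = indicator J"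
    by (auto simp: indicator_def)
  finally show ?thesis .
qed

lemma measure_between:
  assumes "a \<le> b" "{a<..<b} \<subseteq> J" "J \<subseteq> {a..b}" "J \<in> sets borel"
  shows "measure lborel J = b - a"
proof (rule antisym)
  have "measure lborel J \<le> measure lborel {a..b}"
    using assms by (intro measure_mono_fmeasurable) (auto simp: fmeasurable_def)
  then show "measure lborel J \<le> b - a" using assms by simp
  have "measure lborel {a<..<b} \<le> measure lborel J"
    using assms emeasure_bounded_finite[OF bounded_subset[OF _ assms(3)]]
    by (intro measure_mono_fmeasurable) (auto simp: fmeasurable_def)
  then show "b - a \<le> measure lborel J" using assms by simp
qed

lemma step_fun_integrable: "step_fun g \<Longrightarrow> integrable lborel g"
  by (induction rule: step_fun.induct)
    (simp_all add: integrable_indicator_bounded_interval del: integrable_indicator_iff)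

lemma step_fun_measurable: "step_fun g \<Longrightarrow> g \<in> borel_measurable borel"
  using borel_measurable_integrable[OF step_fun_integrable] by simp

lemma step_fun_add:
  assumes "step_fun g" "step_fun h"
  shows "step_fun (\<lambda>\<xi>. g \<xi> + h \<xi>)"
  using assms(2)
proof (induction rule: step_fun.induct)
  case zero
  show ?case using assms(1) by simp
next
  case (add_indicator h J c)
  have "step_fun (\<lambda>\<xi>. (g \<xi> + h \<xi>) + c * indicator J \<xi>)"
    by (intro step_fun.add_indicator add_indicator)
  then show ?case by (simp add: add.assoc)
qed

lemma step_fun_cmult:
  assumes "step_fun g"
  shows "step_fun (\<lambda>\<xi>. c * g \<xi>)"
  using assms
proof (induction rule: step_fun.induct)
  case zero
  show ?case using step_fun.zero by simp
next
  case (add_indicator h J d)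
  have "step_fun (\<lambda>\<xi>. (c * h \<xi>) + (c * d) * indicator J \<xi>)"
    by (intro step_fun.add_indicator add_indicator)
  then show ?case by (simp add: algebra_simps)
qed

lemma step_fun_indicator_mult:
  assumes "step_fun g" "is_interval I"
  shows "step_fun (\<lambda>\<xi>. indicator I \<xi> * g \<xi>)"
  using assms(1)
proof (induction rule: step_fun.induct)
  case zero
  show ?case using step_fun.zero by simp
next
  case (add_indicator h J d)
  have "step_fun (\<lambda>\<xi>. indicator I \<xi> * h \<xi> + d * indicator (I \<inter> J) \<xi>)"
    using add_indicator assms(2)
    by (intro step_fun.add_indicator add_indicator) (auto intro: is_interval_Int bounded_subset)
  then show ?case by (simp add: algebra_simps indicator_inter_arith)
qed

lemma step_fun_sum:
  "finite A \<Longrightarrow> (\<And>i. i \<in> A \<Longrightarrow> step_fun (g i)) \<Longrightarrow> step_fun (\<lambda>\<xi>. \<Sum>i\<in>A. g i \<xi>)"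
  by (induction rule: finite_induct) (auto intro: step_fun.zero step_fun_add)

lemma step_fun_indicator:
  "is_interval J \<Longrightarrow> bounded J \<Longrightarrow> step_fun (indicator J)"
  using step_fun.add_indicator[OF step_fun.zero, of J 1] by simp

section \<open>Inverse transforms of step functions and their decay\<close>

lemma integrable_cis_mult:
  fixes g :: "real \<Rightarrow> complex"
  assumes "integrable lborel g"
  shows "integrable lborel (\<lambda>\<xi>. cis (t * \<xi>) * g \<xi>)"
proof (rule Bochner_Integration.integrable_bound[OF integrable_norm[OF assms]])
  have [measurable]: "g \<in> borel_measurable borel"
    using borel_measurable_integrable[OF assms] by simp
  show "(\<lambda>\<xi>. cis (t * \<xi>) * g \<xi>) \<in> borel_measurable lborel"
    unfolding cis_conv_exp by measurable
qed (simp add: norm_mult)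

lemma inv_fourier_add:
  assumes "integrable lborel g" "integrable lborel h"
  shows "inv_fourier (\<lambda>\<xi>. g \<xi> + h \<xi>) x = inv_fourier g x + inv_fourier h x"
  unfolding inv_fourier_def ring_distribs
  by (intro Bochner_Integration.integral_add integrable_cis_mult assms)

lemma inv_fourier_cmult: "inv_fourier (\<lambda>\<xi>. c * g \<xi>) x = c * inv_fourier g x"
  unfolding inv_fourier_def by (simp add: mult.left_commute)

lemma inv_fourier_sum:
  assumes "\<And>i. i \<in> A \<Longrightarrow> integrable lborel (g i)"
  shows "inv_fourier (\<lambda>\<xi>. \<Sum>i\<in>A. g i \<xi>) x = (\<Sum>i\<in>A. inv_fourier (g i) x)"
  unfolding inv_fourier_def sum_distrib_left
  by (intro Bochner_Integration.integral_sum integrable_cis_mult assms)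

lemma norm_inv_fourier_le: "cmod (inv_fourier g x) \<le> (LINT \<xi>|lborel. cmod (g \<xi>))"
proof -
  have "cmod (inv_fourier g x) \<le> (LINT \<xi>|lborel. cmod (cis (2 * pi * x * \<xi>) * g \<xi>))"
    unfolding inv_fourier_def by (rule integral_norm_bound)
  then show ?thesis by (simp add: norm_mult)
qed

lemma measurable_inv_fourier:
  assumes [measurable]: "g \<in> borel_measurable borel"
  shows "inv_fourier g \<in> borel_measurable borel"
  unfolding inv_fourier_def cis_conv_exp by measurable

lemma inv_fourier_cong_AE:
  assumes "AE \<xi> in lborel. g \<xi> = h \<xi>" "g \<in> borel_measurable borel" "h \<in> borel_measurable borel"
  shows "inv_fourier g x = inv_fourier h x"
proof -
  note [measurable] = assms(2,3)
  show ?thesis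
    unfolding inv_fourier_def cis_conv_exp
    by (intro integral_cong_AE) (use assms(1) in auto)
qed

lemma inv_fourier_indicator_Icc:
  assumes "a \<le> b" "x \<noteq> 0"
  shows "inv_fourier (indicator {a..b}) x = (cis (2 * pi * x * b) - cis (2 * pi * x * a)) / (2 * pi * \<i> * x)"
proof -
  let ?F = "\<lambda>\<xi>. cis (2 * pi * x * \<xi>) / (2 * pi * \<i> * x)"
  have "(LINT \<xi>|lborel. indicator {a..b} \<xi> *\<^sub>R cis (2 * pi * x * \<xi>)) = ?F b - ?F a"
  proof (rule integral_FTC_Icc)
    show "(?F has_vector_derivative cis (2 * pi * x * \<xi>)) (at \<xi> within {a..b})" for \<xi>
    proof -
      have "((\<lambda>z. exp (\<i> * (2 * pi * x * z)) / (2 * pi * \<i> * x)) has_field_derivative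
          exp (\<i> * (2 * pi * x * \<xi>))) (at (of_real \<xi>))"
        using assms(2) by (auto intro!: derivative_eq_intros)
      from has_vector_derivative_real_field[OF this, of "{a..b}"]
      show ?thesis by (simp add: cis_conv_exp)
    qed
    show "continuous_on {a..b} (\<lambda>\<xi>. cis (2 * pi * x * \<xi>))"
      unfolding cis_conv_exp by (intro continuous_intros)
  qed fact
  moreover have "(\<lambda>\<xi>. indicator {a..b} \<xi> *\<^sub>R cis (2 * pi * x * \<xi>)) = (\<lambda>\<xi>. cis (2 * pi * x * \<xi>) * indicator {a..b} \<xi>)"
    by (auto simp: indicator_def)
  ultimately show ?thesis
    unfolding inv_fourier_def by (simp add: diff_divide_distrib)
qed

lemma inv_fourier_indicator_eq_Icc:
  assumes "a \<le> b" "{a<..<b} \<subseteq> J" "J \<subseteq> {a..b}" "J \<in> sets borel"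
  shows "inv_fourier (indicator J) x = inv_fourier (indicator {a..b}) x"
proof (rule inv_fourier_cong_AE)
  have "AE \<xi> in lborel. \<xi> \<noteq> a \<and> \<xi> \<noteq> b"
    using AE_lborel_singleton[of a] AE_lborel_singleton[of b] by eventually_elim auto
  then show "AE \<xi> in lborel. (indicator J \<xi> :: complex) = indicator {a..b} \<xi>"
  proof eventually_elim
    case (elim \<xi>)
    then have "\<xi> \<in> J \<longleftrightarrow> \<xi> \<in> {a..b}"
      using subsetD[OF assms(2), of \<xi>] subsetD[OF assms(3), of \<xi>] by auto
    then show ?case by (simp add: indicator_def)
  qed
qed (use assms in auto)

lemma inv_fourier_indicator_decay:
  assumes "is_interval J" "bounded J"
  shows "\<exists>C. \<forall>x. cmod (inv_fourier (indicator J) x) \<le> C / (1 + \<bar>x\<bar>)"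
proof (cases "J = {}")
  case True
  then show ?thesis by (intro exI[of _ 0]) (simp add: inv_fourier_def)
next
  case False
  then obtain a b where ab: "a \<le> b" "{a<..<b} \<subseteq> J" "J \<subseteq> {a..b}"
    using bounded_interval_endpoints assms by metis
  have J: "J \<in> sets borel" using assms(1) by (rule real_interval_borel_measurable)
  define I where "I = (LINT \<xi>|lborel. cmod (indicator J \<xi>))"
  \<comment> \<open>The term 2 I serves |x| <= 1, where the transform is at most I and 1 + |x| <= 2.
    The term 2 serves |x| > 1, where the explicit formula has numerator at most 2 and 1 + |x| <= 2
    pi |x|.\<close>
  have "cmod (inv_fourier (indicator J) x) \<le> (2 * I + 2) / (1 + \<bar>x\<bar>)" for x
  proof (cases "\<bar>x\<bar> \<le> 1")
    case True
    have I: "0 \<le> I" by (simp add: I_def)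
    have "cmod (inv_fourier (indicator J) x) * (1 + \<bar>x\<bar>) \<le> I * 2"
      using norm_inv_fourier_le[of "indicator J" x] True I by (intro mult_mono) (auto simp: I_def)
    then show ?thesis by (simp add: field_simps)
  next
    case False
    then have x: "x \<noteq> 0" by auto
    have I: "0 \<le> I" by (simp add: I_def)
    have "cmod (inv_fourier (indicator J) x) = cmod (cis (2 * pi * x * b) - cis (2 * pi * x * a)) / (2 * pi * \<bar>x\<bar>)"
      unfolding inv_fourier_indicator_eq_Icc[OF ab J] inv_fourier_indicator_Icc[OF ab(1) x]
      by (simp add: norm_divide norm_mult)
    also have "\<dots> \<le> 2 / (2 * pi * \<bar>x\<bar>)"
      using norm_triangle_ineq4[of "cis (2 * pi * x * b)" "cis (2 * pi * x * a)"]
      by (intro divide_right_mono) auto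
    also have "\<dots> \<le> 2 / (1 + \<bar>x\<bar>)"
    proof (rule divide_left_mono)
      have "1 + \<bar>x\<bar> \<le> 2 * \<bar>x\<bar>" using False by simp
      also have "\<dots> \<le> 2 * pi * \<bar>x\<bar>" using pi_gt3 by (intro mult_right_mono) auto
      finally show "1 + \<bar>x\<bar> \<le> 2 * pi * \<bar>x\<bar>" .
    qed (use x in auto)
    also have "\<dots> \<le> (2 * I + 2) / (1 + \<bar>x\<bar>)" using I by (intro divide_right_mono) auto
    finally show ?thesis .
  qed
  then show ?thesis by blast
qed

lemma step_fun_inv_fourier_decay:
  assumes "step_fun g"
  shows "\<exists>C. \<forall>x. cmod (inv_fourier g x) \<le> C / (1 + \<bar>x\<bar>)"
  using assms
proof (induction rule: step_fun.induct)
  case zero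
  show ?case by (intro exI[of _ 0]) (simp add: inv_fourier_def)
next
  case (add_indicator g J c)
  obtain C D where C: "\<And>x. cmod (inv_fourier g x) \<le> C / (1 + \<bar>x\<bar>)"
    and D: "\<And>x. cmod (inv_fourier (indicator J) x) \<le> D / (1 + \<bar>x\<bar>)"
    using add_indicator.IH inv_fourier_indicator_decay[OF add_indicator.hyps(2,3)] by blast
  have "cmod (inv_fourier (\<lambda>\<xi>. g \<xi> + c * indicator J \<xi>) x) \<le> (C + cmod c * D) / (1 + \<bar>x\<bar>)" for x
  proof -
    have "inv_fourier (\<lambda>\<xi>. g \<xi> + c * indicator J \<xi>) x = inv_fourier g x + c * inv_fourier (indicator J) x"
      using add_indicator
      by (subst inv_fourier_add)
        (simp_all add: step_fun_integrable integrable_indicator_bounded_interval inv_fourier_cmult)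
    also have "cmod \<dots> \<le> C / (1 + \<bar>x\<bar>) + cmod c * (D / (1 + \<bar>x\<bar>))"
      unfolding norm_mult[symmetric]
      by (intro norm_triangle_mono C) (simp only: norm_mult mult_left_mono[OF D] norm_ge_zero)
    finally show ?thesis by (simp add: add_divide_distrib)
  qed
  then show ?case by blast
qed

lemma step_fun_decay:
  assumes "step_fun g"
  shows "\<exists>C. \<forall>x. cmod (g x) \<le> C / (1 + \<bar>x\<bar>)"
  using assms
proof (induction rule: step_fun.induct)
  case zero
  show ?case by (intro exI[of _ 0]) simp
next
  case (add_indicator g J c)
  obtain C where C: "\<And>x. cmod (g x) \<le> C / (1 + \<bar>x\<bar>)"
    using add_indicator.IH by blast
  obtain B where B: "\<And>x. x \<in> J \<Longrightarrow> \<bar>x\<bar> \<le> B"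
    using add_indicator.hyps(3) by (auto simp: bounded_iff)
  have D: "cmod (indicator J x) \<le> (1 + B) / (1 + \<bar>x\<bar>)" if "x \<in> J" for x
    using B[OF that] that by (simp add: field_simps)
  have B': "cmod (indicator J x) \<le> \<bar>1 + B\<bar> / (1 + \<bar>x\<bar>)" for x
    using D[of x] by (cases "x \<in> J") (auto intro: order_trans divide_right_mono)
  have "cmod (g x + c * indicator J x) \<le> (C + cmod c * \<bar>1 + B\<bar>) / (1 + \<bar>x\<bar>)" for x
  proof -
    have "cmod (g x + c * indicator J x) \<le> C / (1 + \<bar>x\<bar>) + cmod c * (\<bar>1 + B\<bar> / (1 + \<bar>x\<bar>))"
    proof (intro norm_triangle_mono C)
      show "cmod (c * indicator J x) \<le> cmod c * (\<bar>1 + B\<bar> / (1 + \<bar>x\<bar>))"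
        unfolding norm_mult by (intro mult_left_mono B') auto
    qed
    then show ?thesis by (simp add: add_divide_distrib)
  qed
  then show ?case by blast
qed

lemma step_fun_mem_Lp: "step_fun g \<Longrightarrow> 1 < p \<Longrightarrow> g \<in> Lp p"
  using step_fun_decay mem_Lp_of_decay step_fun_measurable by metis

lemma inv_fourier_mem_Lp: "step_fun g \<Longrightarrow> 1 < p \<Longrightarrow> inv_fourier g \<in> Lp p"
  using step_fun_inv_fourier_decay mem_Lp_of_decay measurable_inv_fourier step_fun_measurable by metis

section \<open>Gaussian regularisation\<close>

text \<open>Rescaling x by s turns the integral into the characteristic function of the standard
  normal law. A wide Gaussian (large s) thus yields a narrow normal density around \<xi>, an
  approximate identity.\<close>

lemma fourier_gaussian:
  assumes "0 < s"
  shows "(LINT x|lborel. cis (2 * pi * x * (\<eta> - \<xi>)) * complex_of_real (exp (- (x / s)\<^sup>2 / 2)))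
    = complex_of_real (normal_density \<xi> (1 / (2 * pi * s)) \<eta>)"
proof -
  define t where "t = 2 * pi * s * (\<eta> - \<xi>)"
  have "(LINT x|lborel. std_normal_density x *\<^sub>R iexp (t * x)) = complex_of_real (exp (- t\<^sup>2 / 2))"
    using fun_cong[OF char_std_normal_distribution, of t] unfolding char_def
    by (subst (asm) integral_density) auto
  then have *: "(LINT x|lborel. complex_of_real (std_normal_density x) * cis (t * x)) = complex_of_real (exp (- t\<^sup>2 / 2))"
    by (simp add: scaleR_conv_of_real cis_conv_exp)
  have "(LINT x|lborel. cis (2 * pi * x * (\<eta> - \<xi>)) * complex_of_real (exp (- (x / s)\<^sup>2 / 2)))
     = s *\<^sub>R (LINT x|lborel. cis (2 * pi * (s * x) * (\<eta> - \<xi>)) * complex_of_real (exp (- (s * x / s)\<^sup>2 / 2)))"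
    by (subst lborel_integral_real_affine[where c=s and t=0]) (use assms in auto)
  also have "(\<lambda>x. cis (2 * pi * (s * x) * (\<eta> - \<xi>)) * complex_of_real (exp (- (s * x / s)\<^sup>2 / 2)))
     = (\<lambda>x. complex_of_real (sqrt (2 * pi)) * (complex_of_real (std_normal_density x) * cis (t * x)))"
    using assms by (auto simp: t_def std_normal_density_def algebra_simps)
  also have "s *\<^sub>R (LINT x|lborel. complex_of_real (sqrt (2 * pi)) * (complex_of_real (std_normal_density x) * cis (t * x)))
     = complex_of_real (s * (sqrt (2 * pi) * exp (- t\<^sup>2 / 2)))"
    unfolding integral_mult_right_zero * by (simp add: scaleR_conv_of_real)
  also have "s * (sqrt (2 * pi) * exp (- t\<^sup>2 / 2)) = normal_density \<xi> (1 / (2 * pi * s)) \<eta>"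
  proof -
    have "sqrt (2 * pi * (1 / (2 * pi * s))\<^sup>2) = sqrt (2 * pi) * (1 / (2 * pi * s))"
      using assms by (simp add: real_sqrt_mult)
    moreover have "1 / (sqrt (2 * pi) * (1 / (2 * pi * s))) = s * sqrt (2 * pi)"
      using assms real_sqrt_mult_self[of "2 * pi"] by (simp add: field_simps)
    moreover have "- (\<eta> - \<xi>)\<^sup>2 / (2 * (1 / (2 * pi * s))\<^sup>2) = - t\<^sup>2 / 2"
      using assms by (simp add: t_def field_simps power2_eq_square)
    ultimately show ?thesis by (simp add: normal_density_def)
  qed
  finally show ?thesis .
qed

text \<open>The convolution of g with a centred normal density, written with the mean moved to the
  point of evaluation.\<close>

definition gauss_conv :: "real \<Rightarrow> (real \<Rightarrow> complex) \<Rightarrow> real \<Rightarrow> complex" where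
  "gauss_conv \<sigma> g \<xi> = (LINT \<eta>|lborel. complex_of_real (normal_density \<xi> \<sigma> \<eta>) * g \<eta>)"

lemma integrable_gaussian:
  assumes "0 < s"
  shows "integrable lborel (\<lambda>x. exp (- (x / s)\<^sup>2 / 2) :: real)"
proof -
  have "(\<lambda>x. exp (- (x / s)\<^sup>2 / 2)) = (\<lambda>x. sqrt (2 * pi * s\<^sup>2) * normal_density 0 s x)"
    using assms by (auto simp: normal_density_def power_divide mult.commute real_sqrt_mult)
  then show ?thesis using assms by simp
qed

text \<open>A regularised inversion formula: the Gaussian factor makes the double integral
  absolutely convergent, so by Fubini the x-integral can be done first, and that one is
  \<open>fourier_gaussian\<close>.\<close>

lemma fourier_integral_inv_fourier_gaussian:
  assumes g: "integrable lborel g" and s: "0 < s"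
  shows "fourier_integral (\<lambda>x. inv_fourier g x * complex_of_real (exp (- (x / s)\<^sup>2 / 2))) \<xi>
    = gauss_conv (1 / (2 * pi * s)) g \<xi>"
proof -
  let ?G = "\<lambda>x. complex_of_real (exp (- (x / s)\<^sup>2 / 2))"
  let ?k = "\<lambda>x \<eta>. cis (2 * pi * x * (\<eta> - \<xi>)) * ?G x * g \<eta>"
  have [measurable]: "g \<in> borel_measurable borel"
    using borel_measurable_integrable[OF g] by simp
  have intG: "integrable lborel (\<lambda>x. exp (- (x / s)\<^sup>2 / 2) :: real)"
    using integrable_gaussian[OF s] .
  have cis_diff: "cis (2 * pi * x * (\<eta> - \<xi>)) = cis (- (2 * pi * \<xi> * x)) * cis (2 * pi * x * \<eta>)" for x \<eta>
    by (simp add: cis_mult algebra_simps)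
  have int: "integrable (lborel \<Otimes>\<^sub>M lborel) (case_prod ?k)"
  proof (rule lborel_pair.Fubini_integrable)
    show "case_prod ?k \<in> borel_measurable (lborel \<Otimes>\<^sub>M lborel)"
      unfolding cis_conv_exp by measurable
    show "integrable lborel (\<lambda>x. LINT y|lborel. norm (case (x, y) of (x, y) \<Rightarrow> ?k x y))"
      using intG by (simp add: norm_mult)
    show "AE x in lborel. integrable lborel (\<lambda>y. case (x, y) of (x, y) \<Rightarrow> ?k x y)"
    proof (rule AE_I2)
      fix x
      have "integrable lborel (\<lambda>y. (cis (- (2 * pi * \<xi> * x)) * ?G x) * (cis ((2 * pi * x) * y) * g y))"
        by (intro integrable_mult_right integrable_cis_mult g)
      also have "(\<lambda>y. (cis (- (2 * pi * \<xi> * x)) * ?G x) * (cis ((2 * pi * x) * y) * g y)) = ?k x"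
        unfolding cis_diff by (auto simp: mult_ac)
      finally show "integrable lborel (\<lambda>y. case (x, y) of (x, y) \<Rightarrow> ?k x y)" by simp
    qed
  qed
  have "fourier_integral (\<lambda>x. inv_fourier g x * ?G x) \<xi> = (LINT x|lborel. LINT \<eta>|lborel. ?k x \<eta>)"
    unfolding fourier_integral_def
  proof (intro Bochner_Integration.integral_cong refl)
    fix x
    have "cis (- (2 * pi * \<xi> * x)) * (inv_fourier g x * ?G x)
        = (cis (- (2 * pi * \<xi> * x)) * ?G x) * (LINT \<eta>|lborel. cis (2 * pi * x * \<eta>) * g \<eta>)"
      by (simp add: inv_fourier_def)
    also have "\<dots> = (LINT \<eta>|lborel. (cis (- (2 * pi * \<xi> * x)) * ?G x) * (cis (2 * pi * x * \<eta>) * g \<eta>))"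
      by (rule integral_mult_right_zero[symmetric])
    also have "\<dots> = (LINT \<eta>|lborel. ?k x \<eta>)"
      unfolding cis_diff by (intro Bochner_Integration.integral_cong refl) (simp add: mult_ac)
    finally show "cis (- (2 * pi * \<xi> * x)) * (inv_fourier g x * ?G x) = (LINT \<eta>|lborel. ?k x \<eta>)" .
  qed
  also have "\<dots> = (LINT \<eta>|lborel. LINT x|lborel. ?k x \<eta>)"
    by (rule lborel_pair.Fubini_integral[OF int, symmetric])
  also have "\<dots> = gauss_conv (1 / (2 * pi * s)) g \<xi>"
    unfolding gauss_conv_def integral_mult_left_zero fourier_gaussian[OF s] ..
  finally show ?thesis .
qed

text \<open>Only a point \<xi> within |t| of an endpoint can have exactly one of \<xi> and \<xi> + t
  in J; the two windows have length 2 |t| each.\<close>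

lemma nn_integral_indicator_shift_le:
  fixes J :: "real set"
  assumes "{a<..<b} \<subseteq> J" "J \<subseteq> {a..b}"
  shows "(\<integral>\<^sup>+\<xi>. ennreal \<bar>indicator J (\<xi> + t) - indicator J \<xi>\<bar> \<partial>lborel) \<le> ennreal (4 * \<bar>t\<bar>)"
proof -
  have "(\<integral>\<^sup>+\<xi>. ennreal \<bar>indicator J (\<xi> + t) - indicator J \<xi>\<bar> \<partial>lborel)
     \<le> (\<integral>\<^sup>+\<xi>. indicator {a - \<bar>t\<bar>..a + \<bar>t\<bar>} \<xi> + indicator {b - \<bar>t\<bar>..b + \<bar>t\<bar>} \<xi> \<partial>lborel)"
  proof (intro nn_integral_mono)
    fix \<xi>
    have "\<xi> \<in> {a - \<bar>t\<bar>..a + \<bar>t\<bar>} \<or> \<xi> \<in> {b - \<bar>t\<bar>..b + \<bar>t\<bar>}" if "\<xi> + t \<in> J \<longleftrightarrow> \<xi> \<notin> J"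
    proof -
      have J: "x \<in> J \<or> x \<le> a \<or> b \<le> x" "x \<in> J \<longrightarrow> a \<le> x \<and> x \<le> b" for x
        using subsetD[OF assms(1), of x] subsetD[OF assms(2), of x] by force+
      show ?thesis
        using that J(1)[of \<xi>] J(2)[of \<xi>] J(1)[of "\<xi> + t"] J(2)[of "\<xi> + t"] by (auto simp: abs_if)
    qed
    then show "ennreal \<bar>indicator J (\<xi> + t) - indicator J \<xi>\<bar>
        \<le> indicator {a - \<bar>t\<bar>..a + \<bar>t\<bar>} \<xi> + indicator {b - \<bar>t\<bar>..b + \<bar>t\<bar>} \<xi>"
      by (auto simp: indicator_def)
  qed
  also have "\<dots> = ennreal (4 * \<bar>t\<bar>)"
    by (subst nn_integral_add) (auto simp flip: ennreal_plus)
  finally show ?thesis .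
qed

lemma integrable_normal_density_mult:
  assumes "0 < \<sigma>" "g \<in> borel_measurable borel" "\<And>x. cmod (g x) \<le> B"
  shows "integrable lborel (\<lambda>\<eta>. complex_of_real (normal_density \<xi> \<sigma> \<eta>) * g \<eta>)"
proof (rule Bochner_Integration.integrable_bound)
  show "integrable lborel (\<lambda>\<eta>. B * normal_density \<xi> \<sigma> \<eta>)"
    using assms(1) by simp
  have "0 \<le> B" using assms(3)[of 0] norm_ge_zero order_trans by blast
  then show "AE \<eta> in lborel. norm (complex_of_real (normal_density \<xi> \<sigma> \<eta>) * g \<eta>) \<le> norm (B * normal_density \<xi> \<sigma> \<eta>)"
    using assms(3) by (auto simp: norm_mult mult.commute intro!: mult_right_mono)
qed (use assms(2) in measurable)

text \<open>The difference is bounded by \<open>1\<close>, so its square is dominated by its absolute value; the \<open>L\<^sup>1\<close>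
  distance from an interval to its translate by \<open>t\<close> is at most \<open>4 \<bar>t\<bar>\<close>.\<close>

lemma Lp_integral_gauss_conv_indicator_le:
  assumes \<sigma>: "0 < \<sigma>" and J: "is_interval J" "bounded J"
  shows "Lp_integral 2 (\<lambda>\<xi>. gauss_conv \<sigma> (indicator J) \<xi> - indicator J \<xi>) \<le> ennreal (4 * \<sigma>)"
proof (cases "J = {}")
  case True
  then show ?thesis by (simp add: gauss_conv_def Lp_integral_def)
next
  case False
  then obtain a b where ab: "a \<le> b" "{a<..<b} \<subseteq> J" "J \<subseteq> {a..b}"
    using bounded_interval_endpoints J by metis
  have [measurable]: "J \<in> sets borel" using J(1) by (rule real_interval_borel_measurable)
  let ?n = "normal_density"
  let ?B = "\<lambda>\<eta> \<xi>. \<bar>indicator J \<eta> - indicator J \<xi>\<bar> :: real"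
  have B: "?B \<eta> \<xi> \<le> 1" for \<eta> \<xi> by (auto simp: indicator_def)
  have pt: "ennreal ((cmod (gauss_conv \<sigma> (indicator J) \<xi> - indicator J \<xi>))\<^sup>2)
      \<le> (\<integral>\<^sup>+t. ennreal (?n 0 \<sigma> t) * ennreal (?B (\<xi> + t) \<xi>) \<partial>lborel)" for \<xi>
  proof -
    let ?D = "\<lambda>\<eta>. indicator J \<eta> - indicator J \<xi> :: complex"
    have nD: "cmod (?D \<eta>) = ?B \<eta> \<xi>" for \<eta> by (auto simp: indicator_def)
    have intD: "integrable lborel (\<lambda>\<eta>. complex_of_real (?n \<xi> \<sigma> \<eta>) * ?D \<eta>)"
      by (rule integrable_normal_density_mult[OF \<sigma>, where B=1]) (use B in \<open>auto simp: nD\<close>)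
    \<comment> \<open>The density has mass 1, so the constant \<open>indicator J \<xi>\<close> may
      be brought under the integral.\<close>
    have "gauss_conv \<sigma> (indicator J) \<xi> - indicator J \<xi>
        = (LINT \<eta>|lborel. complex_of_real (?n \<xi> \<sigma> \<eta>) * indicator J \<eta>) - (LINT \<eta>|lborel. complex_of_real (?n \<xi> \<sigma> \<eta>) * indicator J \<xi>)"
      using \<sigma> by (simp add: gauss_conv_def)
    also have "\<dots> = (LINT \<eta>|lborel. complex_of_real (?n \<xi> \<sigma> \<eta>) * ?D \<eta>)"
      unfolding right_diff_distrib
      by (intro Bochner_Integration.integral_diff[symmetric] integrable_normal_density_mult[OF \<sigma>, where B=1]) (auto simp: indicator_def)
    finally have "cmod (gauss_conv \<sigma> (indicator J) \<xi> - indicator J \<xi>) \<le> (LINT \<eta>|lborel. cmod (complex_of_real (?n \<xi> \<sigma> \<eta>) * ?D \<eta>))"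
      by (simp only: integral_norm_bound)
    also have "\<dots> = (LINT \<eta>|lborel. ?n \<xi> \<sigma> \<eta> * ?B \<eta> \<xi>)"
      by (simp add: norm_mult nD)
    finally have le: "cmod (gauss_conv \<sigma> (indicator J) \<xi> - indicator J \<xi>) \<le> (LINT \<eta>|lborel. ?n \<xi> \<sigma> \<eta> * ?B \<eta> \<xi>)" .
    have int: "integrable lborel (\<lambda>\<eta>. ?n \<xi> \<sigma> \<eta> * ?B \<eta> \<xi>)"
      using integrable_norm[OF intD] by (simp add: norm_mult nD)
    have "(LINT \<eta>|lborel. ?n \<xi> \<sigma> \<eta> * ?B \<eta> \<xi>) \<le> (LINT \<eta>|lborel. ?n \<xi> \<sigma> \<eta>)"
      using \<sigma> B by (intro integral_mono int) (auto intro: mult_left_le)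
    with le have le1: "cmod (gauss_conv \<sigma> (indicator J) \<xi> - indicator J \<xi>) \<le> 1"
      using \<sigma> by simp
    have "(cmod (gauss_conv \<sigma> (indicator J) \<xi> - indicator J \<xi>))\<^sup>2 \<le> cmod (gauss_conv \<sigma> (indicator J) \<xi> - indicator J \<xi>)"
      unfolding power2_eq_square using le1 by (intro mult_left_le) auto
    also note le
    finally have "ennreal ((cmod (gauss_conv \<sigma> (indicator J) \<xi> - indicator J \<xi>))\<^sup>2) \<le> ennreal (LINT \<eta>|lborel. ?n \<xi> \<sigma> \<eta> * ?B \<eta> \<xi>)"
      by (rule ennreal_leI)
    also have "\<dots> = (\<integral>\<^sup>+\<eta>. ennreal (?n \<xi> \<sigma> \<eta> * ?B \<eta> \<xi>) \<partial>lborel)"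
      by (rule nn_integral_eq_integral[OF int, symmetric]) auto
    also have "\<dots> = (\<integral>\<^sup>+t. ennreal (?n \<xi> \<sigma> (\<xi> + 1 * t) * ?B (\<xi> + 1 * t) \<xi>) \<partial>lborel)"
      by (subst nn_integral_real_affine[where c=1 and t=\<xi>]) auto
    also have "\<dots> = (\<integral>\<^sup>+t. ennreal (?n 0 \<sigma> t) * ennreal (?B (\<xi> + t) \<xi>) \<partial>lborel)"
    proof (intro nn_integral_cong)
      fix t
      have "?n \<xi> \<sigma> (\<xi> + 1 * t) = ?n 0 \<sigma> t" by (simp add: normal_density_def)
      then show "ennreal (?n \<xi> \<sigma> (\<xi> + 1 * t) * ?B (\<xi> + 1 * t) \<xi>) = ennreal (?n 0 \<sigma> t) * ennreal (?B (\<xi> + t) \<xi>)"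
        by (simp add: ennreal_mult)
    qed
    finally show ?thesis .
  qed
  have "Lp_integral 2 (\<lambda>\<xi>. gauss_conv \<sigma> (indicator J) \<xi> - indicator J \<xi>)
      \<le> (\<integral>\<^sup>+\<xi>. \<integral>\<^sup>+t. ennreal (?n 0 \<sigma> t) * ennreal (?B (\<xi> + t) \<xi>) \<partial>lborel \<partial>lborel)"
    unfolding Lp_integral_2 by (intro nn_integral_mono pt)
  also have "\<dots> = (\<integral>\<^sup>+t. \<integral>\<^sup>+\<xi>. ennreal (?n 0 \<sigma> t) * ennreal (?B (\<xi> + t) \<xi>) \<partial>lborel \<partial>lborel)"
    by (rule lborel_pair.Fubini') simp
  also have "\<dots> \<le> (\<integral>\<^sup>+t. ennreal (?n 0 \<sigma> t) * ennreal (4 * \<bar>t\<bar>) \<partial>lborel)"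
    using nn_integral_indicator_shift_le[OF ab(2,3)]
    by (intro nn_integral_mono) (auto simp: nn_integral_cmult intro!: mult_left_mono)
  \<comment> \<open>What remains is 4 times the first absolute moment of the normal density; that
    moment is \<sigma> sqrt(2 / pi), at most \<sigma>.\<close>
  also have "\<dots> = (\<integral>\<^sup>+t. ennreal (4 * (?n 0 \<sigma> t * \<bar>t - 0\<bar> ^ (2 * 0 + 1))) \<partial>lborel)"
    by (intro nn_integral_cong) (simp add: ennreal_mult[symmetric] mult_ac)
  also have "\<dots> = ennreal (4 * (2 ^ 0 * \<sigma> ^ (2 * 0 + 1) * fact 0 * sqrt (2 / pi)))"
    by (rule nn_integral_eq_integral[THEN trans])
      (use normal_moment_abs_odd[OF \<sigma>, of 0 0] in \<open>auto simp: has_bochner_integral_iff\<close>)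
  also have "\<dots> \<le> ennreal (4 * \<sigma>)"
    using \<sigma> pi_gt3 by (intro ennreal_leI) (auto intro!: mult_left_le)
  finally show ?thesis .
qed

lemma gauss_conv_add_cmult:
  assumes "0 < \<sigma>" "step_fun g" "is_interval J"
  shows "gauss_conv \<sigma> (\<lambda>\<xi>. g \<xi> + c * indicator J \<xi>) \<xi> = gauss_conv \<sigma> g \<xi> + c * gauss_conv \<sigma> (indicator J) \<xi>"
proof -
  obtain C where C: "\<And>x. cmod (g x) \<le> C / (1 + \<bar>x\<bar>)" using step_fun_decay[OF assms(2)] by blast
  have "0 \<le> C" using C[of 0] order_trans[OF norm_ge_zero] by fastforce
  then have "C / (1 + \<bar>x\<bar>) \<le> C" for x by (simp add: field_simps)
  then have bg: "cmod (g x) \<le> C" for x using C order_trans by blast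
  have [measurable]: "J \<in> sets borel" using assms(3) by (rule real_interval_borel_measurable)
  have "gauss_conv \<sigma> (\<lambda>\<xi>. g \<xi> + c * indicator J \<xi>) \<xi>
     = gauss_conv \<sigma> g \<xi> + (LINT \<eta>|lborel. complex_of_real (normal_density \<xi> \<sigma> \<eta>) * (c * indicator J \<eta>))"
    unfolding gauss_conv_def ring_distribs
  proof (rule Bochner_Integration.integral_add)
    show "integrable lborel (\<lambda>\<eta>. complex_of_real (normal_density \<xi> \<sigma> \<eta>) * g \<eta>)"
      by (rule integrable_normal_density_mult[OF assms(1) step_fun_measurable[OF assms(2)] bg])
    show "integrable lborel (\<lambda>\<eta>. complex_of_real (normal_density \<xi> \<sigma> \<eta>) * (c * indicator J \<eta>))"
      by (rule integrable_normal_density_mult[OF assms(1), where B="cmod c"]) (auto simp: indicator_def)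
  qed
  then show ?thesis
    by (simp add: gauss_conv_def mult.left_commute)
qed

lemma measurable_gauss_conv:
  assumes [measurable]: "g \<in> borel_measurable borel"
  shows "gauss_conv \<sigma> g \<in> borel_measurable borel"
  unfolding gauss_conv_def normal_density_def by measurable

text \<open>A triangle inequality at the level of squares, from (u + v)^2 <= 2 u^2 + 2 v^2; the
  factor 2 is harmless for limits equal to 0.\<close>

lemma Lp_integral_2_add_le:
  assumes [measurable]: "f \<in> borel_measurable borel" "g \<in> borel_measurable borel"
  shows "Lp_integral 2 (\<lambda>x. f x + g x) \<le> 2 * Lp_integral 2 f + 2 * Lp_integral 2 g"
proof -
  have "Lp_integral 2 (\<lambda>x. f x + g x) \<le> (\<integral>\<^sup>+x. 2 * ennreal ((cmod (f x))\<^sup>2) + 2 * ennreal ((cmod (g x))\<^sup>2) \<partial>lborel)"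
    unfolding Lp_integral_2
  proof (intro nn_integral_mono)
    fix x
    have "(cmod (f x + g x))\<^sup>2 \<le> (cmod (f x) + cmod (g x))\<^sup>2"
      by (intro power_mono norm_triangle_ineq) auto
    also have "\<dots> \<le> 2 * (cmod (f x))\<^sup>2 + 2 * (cmod (g x))\<^sup>2"
      using sum_squares_bound[of "cmod (f x)" "cmod (g x)"] by (simp add: power2_sum)
    finally have "ennreal ((cmod (f x + g x))\<^sup>2) \<le> ennreal (2 * (cmod (f x))\<^sup>2 + 2 * (cmod (g x))\<^sup>2)"
      by (rule ennreal_leI)
    then show "ennreal ((cmod (f x + g x))\<^sup>2) \<le> 2 * ennreal ((cmod (f x))\<^sup>2) + 2 * ennreal ((cmod (g x))\<^sup>2)"
      by (simp add: ennreal_mult)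
  qed
  also have "\<dots> = 2 * Lp_integral 2 f + 2 * Lp_integral 2 g"
    unfolding Lp_integral_2 by (simp add: nn_integral_add nn_integral_cmult)
  finally show ?thesis .
qed

text \<open>By induction on the step function: each new indicator adds an error of order
  \<open>\<sigma> n\<close>, by the bound for one interval.\<close>

lemma Lp_integral_gauss_conv_tendsto:
  assumes "step_fun g" and \<sigma>: "\<And>n. 0 < \<sigma> n" "\<sigma> \<longlonglongrightarrow> 0"
  shows "(\<lambda>n. Lp_integral 2 (\<lambda>\<xi>. gauss_conv (\<sigma> n) g \<xi> - g \<xi>)) \<longlonglongrightarrow> 0"
  using assms(1)
proof (induction rule: step_fun.induct)
  case zero
  show ?case by (simp add: gauss_conv_def Lp_integral_def)
next
  case (add_indicator g J c)
  have [measurable]: "J \<in> sets borel" "g \<in> borel_measurable borel"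
    using add_indicator.hyps by (auto intro: real_interval_borel_measurable step_fun_measurable)
  note [measurable] = measurable_gauss_conv
  let ?e = "\<lambda>n \<xi>. gauss_conv (\<sigma> n) g \<xi> - g \<xi>"
  let ?f = "\<lambda>n \<xi>. gauss_conv (\<sigma> n) (indicator J) \<xi> - indicator J \<xi>"
  have bound: "Lp_integral 2 (\<lambda>\<xi>. gauss_conv (\<sigma> n) (\<lambda>\<xi>. g \<xi> + c * indicator J \<xi>) \<xi> - (g \<xi> + c * indicator J \<xi>))
     \<le> 2 * Lp_integral 2 (?e n) + 2 * (ennreal (cmod c powr 2) * ennreal (4 * \<sigma> n))" for n
  proof -
    have eq: "(\<lambda>\<xi>. gauss_conv (\<sigma> n) (\<lambda>\<xi>. g \<xi> + c * indicator J \<xi>) \<xi> - (g \<xi> + c * indicator J \<xi>))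
        = (\<lambda>\<xi>. ?e n \<xi> + c * ?f n \<xi>)"
      using \<sigma> add_indicator.hyps by (simp add: gauss_conv_add_cmult algebra_simps)
    have "Lp_integral 2 (\<lambda>\<xi>. ?e n \<xi> + c * ?f n \<xi>) \<le> 2 * Lp_integral 2 (?e n) + 2 * Lp_integral 2 (\<lambda>\<xi>. c * ?f n \<xi>)"
      by (rule Lp_integral_2_add_le) measurable
    also have "Lp_integral 2 (\<lambda>\<xi>. c * ?f n \<xi>) = ennreal (cmod c powr 2) * Lp_integral 2 (?f n)"
      by (rule Lp_integral_cmult) measurable
    also have "2 * Lp_integral 2 (?e n) + 2 * (ennreal (cmod c powr 2) * Lp_integral 2 (?f n))
        \<le> 2 * Lp_integral 2 (?e n) + 2 * (ennreal (cmod c powr 2) * ennreal (4 * \<sigma> n))"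
      using \<sigma> add_indicator.hyps
      by (intro add_left_mono mult_left_mono Lp_integral_gauss_conv_indicator_le) auto
    finally show ?thesis unfolding eq .
  qed
  have "(\<lambda>n. 2 * Lp_integral 2 (?e n) + 2 * (ennreal (cmod c powr 2) * ennreal (4 * \<sigma> n))) \<longlonglongrightarrow> 2 * 0 + 2 * (ennreal (cmod c powr 2) * ennreal (4 * 0))"
    by (intro tendsto_add ennreal_tendsto_cmult tendsto_ennrealI tendsto_mult tendsto_const add_indicator.IH \<sigma>) auto
  then show ?case
    by (intro tendsto_sandwich[OF _ always_eventually[OF allI[OF bound]] tendsto_const]) auto
qed

text \<open>In general \<open>inv_fourier g\<close> is not in L^1, so \<open>is_fourier\<close>
  calls for approximants. Multiplying by ever wider Gaussians supplies them: they converge to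
  \<open>inv_fourier g\<close> by dominated convergence, and their Fourier integrals are
  \<open>gauss_conv\<close> of g with standard deviations tending to 0.\<close>

lemma is_fourier_inv_fourier:
  assumes g: "step_fun g"
  shows "is_fourier (inv_fourier g) g"
  unfolding is_fourier_def
proof (intro conjI exI allI)
  show "inv_fourier g \<in> Lp 2" using inv_fourier_mem_Lp[OF g, of 2] by simp
  then have fin: "Lp_integral 2 (inv_fourier g) < \<infinity>" by (simp add: mem_Lp_iff)
  show "g \<in> Lp 2" using step_fun_mem_Lp[OF g, of 2] by simp
  have [measurable]: "inv_fourier g \<in> borel_measurable borel"
    by (intro measurable_inv_fourier step_fun_measurable g)
  define s where "s n = real (Suc n)" for n
  have s: "0 < s n" for n by (simp add: s_def)
  define G where "G n x = complex_of_real (exp (- (x / s n)\<^sup>2 / 2))" for n x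
  have [measurable]: "G n \<in> borel_measurable borel" for n
    unfolding G_def by measurable
  have G1: "cmod (G n x) \<le> 1" for n x by (simp add: G_def)
  define u where "u n x = inv_fourier g x * G n x" for n x
  have [measurable]: "u n \<in> borel_measurable borel" for n
    unfolding u_def by measurable
  show "u n \<in> Lp 1 \<inter> Lp 2" for n
  proof -
    have u2: "u n \<in> Lp 2"
    proof -
      have "Lp_integral 2 (u n) \<le> Lp_integral 2 (inv_fourier g)"
        using G1 by (intro Lp_integral_mono) (auto simp: u_def norm_mult intro: mult_left_le)
      then show ?thesis using fin by (auto simp: mem_Lp_iff)
    qed
    \<comment> \<open>\<open>inv_fourier g\<close> is bounded by the L^1 norm of g, so the Gaussian
      alone provides integrability.\<close>
    have "Lp_integral 1 (u n) \<le> (\<integral>\<^sup>+x. ennreal ((LINT \<xi>|lborel. cmod (g \<xi>)) * exp (- (x / s n)\<^sup>2 / 2)) \<partial>lborel)"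
      unfolding Lp_integral_1
      by (intro nn_integral_mono ennreal_leI) (auto simp: u_def G_def norm_mult intro: mult_right_mono norm_inv_fourier_le)
    also have "\<dots> < \<infinity>"
      using integrable_gaussian[OF s]
      by (subst nn_integral_eq_integral) auto
    finally show ?thesis using u2 by (simp add: mem_Lp_iff)
  qed
  show "Lp_tendsto 2 u (inv_fourier g)"
  proof (rule Lp_tendstoI)
    let ?w = "\<lambda>x. ennreal ((cmod (inv_fourier g x))\<^sup>2)"
    have "(\<lambda>n. \<integral>\<^sup>+x. ennreal ((cmod (u n x - inv_fourier g x))\<^sup>2) \<partial>lborel) \<longlonglongrightarrow> (\<integral>\<^sup>+(x::real). 0 \<partial>lborel)"
    proof (rule nn_integral_dominated_convergence[where w="\<lambda>x. 4 * ?w x"])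
      show "AE x in lborel. ennreal ((cmod (u n x - inv_fourier g x))\<^sup>2) \<le> 4 * ?w x" for n
      proof (rule AE_I2)
        fix x
        have "cmod (u n x - inv_fourier g x) \<le> 2 * cmod (inv_fourier g x)"
          using norm_triangle_ineq4[of "u n x" "inv_fourier g x"] mult_left_le[OF G1[of n x] norm_ge_zero[of "inv_fourier g x"]]
          by (simp add: u_def norm_mult)
        then have "(cmod (u n x - inv_fourier g x))\<^sup>2 \<le> (2 * cmod (inv_fourier g x))\<^sup>2"
          by (intro power_mono) auto
        then have "ennreal ((cmod (u n x - inv_fourier g x))\<^sup>2) \<le> ennreal (4 * (cmod (inv_fourier g x))\<^sup>2)"
          by (intro ennreal_leI) (simp add: power_mult_distrib)
        then show "ennreal ((cmod (u n x - inv_fourier g x))\<^sup>2) \<le> 4 * ?w x"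
          by (simp add: ennreal_mult)
      qed
      show "(\<integral>\<^sup>+x. 4 * ?w x \<partial>lborel) < \<infinity>"
        using fin by (simp add: nn_integral_cmult Lp_integral_2 ennreal_mult_less_top)
      show "AE x in lborel. (\<lambda>n. ennreal ((cmod (u n x - inv_fourier g x))\<^sup>2)) \<longlonglongrightarrow> 0"
      proof (rule AE_I2)
        fix x
        have "(\<lambda>n. x / s n) \<longlonglongrightarrow> 0"
          unfolding s_def by (intro tendsto_divide_0[OF tendsto_const] filterlim_compose[OF filterlim_real_at_infinity_sequentially] filterlim_Suc)
        then have "(\<lambda>n. exp (- (x / s n)\<^sup>2 / 2)) \<longlonglongrightarrow> exp (- 0\<^sup>2 / 2)"
          by (intro tendsto_intros) auto
        then have "(\<lambda>n. G n x) \<longlonglongrightarrow> 1"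
          unfolding G_def using tendsto_of_real by fastforce
        then have "(\<lambda>n. (cmod (u n x - inv_fourier g x))\<^sup>2) \<longlonglongrightarrow> (cmod (inv_fourier g x * 1 - inv_fourier g x))\<^sup>2"
          unfolding u_def by (intro tendsto_intros)
        then show "(\<lambda>n. ennreal ((cmod (u n x - inv_fourier g x))\<^sup>2)) \<longlonglongrightarrow> 0"
          using tendsto_ennrealI by fastforce
      qed
    qed measurable
    then show "(\<lambda>n. Lp_integral 2 (\<lambda>x. u n x - inv_fourier g x)) \<longlonglongrightarrow> 0"
      by (simp add: Lp_integral_2)
  qed simp
  show "Lp_tendsto 2 (\<lambda>n. fourier_integral (u n)) g"
  proof (rule Lp_tendstoI)
    have eq: "fourier_integral (u n) = gauss_conv (1 / (2 * pi * s n)) g" for n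
      using fourier_integral_inv_fourier_gaussian[OF step_fun_integrable[OF g] s[of n]]
      unfolding u_def G_def by auto
    have "(\<lambda>n. 1 / (2 * pi) * inverse (real (Suc n))) \<longlonglongrightarrow> 1 / (2 * pi) * 0"
      by (intro tendsto_mult tendsto_const LIMSEQ_inverse_real_of_nat)
    then have "(\<lambda>n. 1 / (2 * pi * s n)) \<longlonglongrightarrow> 0"
      by (simp add: s_def field_simps)
    then show "(\<lambda>n. Lp_integral 2 (\<lambda>x. fourier_integral (u n) x - g x)) \<longlonglongrightarrow> 0"
      unfolding eq by (intro Lp_integral_gauss_conv_tendsto g) (use s in auto)
  qed simp
qed

section \<open>Sign multipliers and non-porous sets\<close>

text \<open>\<open>inv_fourier g\<close> already lies in both L^2 and L^p, so constant sequences
  serve in the definition by density.\<close>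

lemma is_freq_restr_inv_fourier:
  assumes "step_fun g" "is_interval I" "1 < p"
  shows "is_freq_restr p I (inv_fourier g) (inv_fourier (\<lambda>\<xi>. indicator I \<xi> * g \<xi>))"
proof -
  have Ig: "step_fun (\<lambda>\<xi>. indicator I \<xi> * g \<xi>)"
    by (rule step_fun_indicator_mult[OF assms(1,2)])
  have "is_freq_restr_L2 I (inv_fourier g) (inv_fourier (\<lambda>\<xi>. indicator I \<xi> * g \<xi>))"
    unfolding is_freq_restr_L2_def using is_fourier_inv_fourier[OF assms(1)] is_fourier_inv_fourier[OF Ig] by blast
  then show ?thesis
    unfolding is_freq_restr_def
    using assms(3) inv_fourier_mem_Lp[OF assms(1)] inv_fourier_mem_Lp[OF Ig]
    by (intro conjI exI[of _ "\<lambda>_. inv_fourier g"] exI[of _ "\<lambda>_. inv_fourier (\<lambda>\<xi>. indicator I \<xi> * g \<xi>)"])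
      (auto intro: Lp_tendsto_const)
qed

lemma is_interval_component:
  fixes U :: "real set"
  shows "I \<in> components U \<Longrightarrow> is_interval I"
  by (simp add: is_interval_connected_1 in_components_connected)

text \<open>The multiplier is -1 on the intervals in F and 1 elsewhere. The lower bound of
  \<open>LP_property\<close> is applied to the multiplied function and the upper bound to the
  original one; they share a square function.\<close>

lemma LP_property_sign_multiplier:
  assumes p: "1 < p" and LP: "LP_property p E"
  shows "\<exists>C>0. \<forall>g F. step_fun g \<and> finite F \<and> F \<subseteq> components (- E) \<longrightarrow>
      Lp_integral p (inv_fourier (\<lambda>\<xi>. (1 - 2 * (\<Sum>I\<in>F. indicator I \<xi>)) * g \<xi>)) \<le> ennreal C * Lp_integral p (inv_fourier g)"
proof -
  obtain c1 c2 :: real where c: "0 < c1" "0 < c2"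
    and LP': "\<forall>f \<in> Lp p. \<forall>h. (\<forall>I \<in> components (- E). is_freq_restr p I f (h I)) \<longrightarrow>
        ennreal c1 * Lp_norm p f \<le> enn_Lp_norm p (square_fun E h) \<and>
        enn_Lp_norm p (square_fun E h) \<le> ennreal c2 * Lp_norm p f"
    using LP unfolding LP_property_def by (elim exE conjE)
  have ineq: "ennreal c1 * Lp_norm p f \<le> enn_Lp_norm p (square_fun E h)"
      "enn_Lp_norm p (square_fun E h) \<le> ennreal c2 * Lp_norm p f"
    if "f \<in> Lp p" "\<And>I. I \<in> components (- E) \<Longrightarrow> is_freq_restr p I f (h I)" for f h
    using LP'[rule_format, of f h] that by simp_all
  show ?thesis
  proof (intro exI[of _ "(c2 / c1) powr p"] conjI allI impI)
    show "0 < (c2 / c1) powr p" using c by simp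
    fix g F assume gF: "step_fun g \<and> finite F \<and> F \<subseteq> components (- E)"
    then have g: "step_fun g" and F: "finite F" "F \<subseteq> components (- E)" by auto
    define mg where "mg \<xi> = (1 - 2 * (\<Sum>I\<in>F. indicator I \<xi>)) * g \<xi>" for \<xi>
    have "mg = (\<lambda>\<xi>. g \<xi> + (-2) * (\<Sum>I\<in>F. indicator I \<xi> * g \<xi>))"
      by (auto simp: mg_def left_diff_distrib sum_distrib_right mult.assoc)
    moreover have "step_fun (\<lambda>\<xi>. \<Sum>I\<in>F. indicator I \<xi> * g \<xi>)"
      using F(2) by (intro step_fun_sum F(1) step_fun_indicator_mult g) (auto intro: is_interval_component)
    ultimately have mg: "step_fun mg"
      using step_fun_add[OF g step_fun_cmult, of _ "-2"] by (simp only:)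
    \<comment> \<open>\<open>LP_property\<close> is quantified over all representatives of the
      restricted functions, so these explicit ones may be inserted, h for g and k for
      \<open>mg\<close>.\<close>
    define h where "h I = inv_fourier (\<lambda>\<xi>. indicator I \<xi> * g \<xi>)" for I
    define k where "k I = inv_fourier (\<lambda>\<xi>. indicator I \<xi> * mg \<xi>)" for I
    have restr: "indicator I \<xi> * mg \<xi> = (if I \<in> F then -1 else 1) * (indicator I \<xi> * g \<xi>)"
      if I: "I \<in> components (- E)" for I \<xi>
    proof (cases "\<xi> \<in> I")
      case True
      \<comment> \<open>Distinct components are disjoint, so at a point of I only the summand for I
        can survive.\<close>
      have "(\<Sum>I'\<in>F. indicator I' \<xi>) = (\<Sum>I'\<in>F. if I' = I then 1 else 0 :: complex)"
      proof (intro sum.cong refl)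
        fix I' assume "I' \<in> F"
        then have "I' \<in> components (- E)" using F by blast
        then have "\<xi> \<in> I' \<longleftrightarrow> I' = I"
          using components_nonoverlap[OF I, of I'] True by blast
        then show "indicator I' \<xi> = (if I' = I then 1 else 0 :: complex)" by (auto simp: indicator_def)
      qed
      also have "\<dots> = (if I \<in> F then 1 else 0)" using F by simp
      finally show ?thesis by (auto simp: mg_def)
    qed simp
    have k: "k I = (\<lambda>x. (if I \<in> F then -1 else 1) * h I x)" if "I \<in> components (- E)" for I
      unfolding k_def h_def restr[OF that] by (rule ext) (rule inv_fourier_cmult)
    have "square_fun E k = square_fun E h"
      unfolding square_fun_def by (rule ext, rule arg_cong2[of _ _ _ _ enn_powr, OF infsum_cong refl]) (auto simp: k)
    moreover have "ennreal c1 * Lp_norm p (inv_fourier mg) \<le> enn_Lp_norm p (square_fun E k)"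
      using ineq(1)[of "inv_fourier mg" k] inv_fourier_mem_Lp[OF mg p] is_freq_restr_inv_fourier[OF mg _ p]
      unfolding k_def by (auto intro: is_interval_component)
    moreover have "enn_Lp_norm p (square_fun E h) \<le> ennreal c2 * Lp_norm p (inv_fourier g)"
      using ineq(2)[of "inv_fourier g" h] inv_fourier_mem_Lp[OF g p] is_freq_restr_inv_fourier[OF g _ p]
      unfolding h_def by (auto intro: is_interval_component)
    ultimately have "ennreal c1 * Lp_norm p (inv_fourier mg) \<le> ennreal c2 * Lp_norm p (inv_fourier g)"
      by (metis order_trans)
    then have "Lp_integral p (inv_fourier mg) \<le> ennreal ((c2 / c1) powr p) * Lp_integral p (inv_fourier g)"
      using p c inv_fourier_mem_Lp[OF mg p] inv_fourier_mem_Lp[OF g p]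
      by (intro Lp_integral_le_of_Lp_norm_le) (auto simp: mem_Lp_iff)
    then show "Lp_integral p (inv_fourier (\<lambda>\<xi>. (1 - 2 * (\<Sum>I\<in>F. indicator I \<xi>)) * g \<xi>)) \<le> ennreal ((c2 / c1) powr p) * Lp_integral p (inv_fourier g)"
      unfolding mg_def .
  qed
qed

section \<open>Filling the cells of an interval where porosity fails\<close>

lemma component_within_cell:
  fixes E :: "real set"
  assumes gaps: "\<And>J. J \<subseteq> {l<..<r} \<Longrightarrow> is_interval J \<Longrightarrow> J \<inter> E = {} \<Longrightarrow> measure lborel J < d"
    and I: "I \<in> components (- E)" "x \<in> I" and x: "l + d \<le> x" "x \<le> r - d"
  shows "I \<subseteq> {l<..<r}"
proof
  fix y assume y: "y \<in> I"
  have d: "0 < d" using gaps[of "{}"] by simp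
  have int: "is_interval I" using I(1) by (rule is_interval_component)
  have disj: "I \<inter> E = {}" using I(1) in_components_subset by blast
  have seg: "{u..v} \<subseteq> I" if "u \<in> I" "v \<in> I" for u v
    by (rule subsetI, rule mem_is_interval_1_I[OF int that]) auto
  show "y \<in> {l<..<r}"
  proof (rule ccontr)
    assume "y \<notin> {l<..<r}"
    \<comment> \<open>If I left the cell, it would contain the whole stretch from x to one end of
      the cell. That stretch misses E and has length at least d, which \<open>gaps\<close>
      excludes.\<close>
    then consider "y \<le> l" | "r \<le> y" by fastforce
    then show False
    proof cases
      case 1
      then have "{l<..x} \<subseteq> I" using seg[OF y I(2)] by force
      then have "{l<..x} \<inter> E = {}" using disj by blast
      then have "measure lborel {l<..x} < d"
        by (intro gaps is_interval_oc) (use x d in auto)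
      then show False using x d by simp
    next
      case 2
      then have "{x..<r} \<subseteq> I" using seg[OF I(2) y] by force
      then have "{x..<r} \<inter> E = {}" using disj by blast
      then have "measure lborel {x..<r} < d"
        by (intro gaps is_interval_co) (use x d in auto)
      then show False using x d by simp
    qed
  qed
qed

text \<open>Since E is null, an open V of measure below d covers it. The part of the cell outside V
  and at distance at least d from both ends is compact and covered by components that stay inside
  the cell, so finitely many suffice. The two margins and V account for 3 d.\<close>

lemma finite_components_fill_cell:
  fixes E :: "real set"
  assumes E: "closed E" "emeasure lborel E = 0"
    and gaps': "\<forall>J. J \<subseteq> {l<..<r} \<and> is_interval J \<and> J \<inter> E = {} \<longrightarrow> measure lborel J < d"
  shows "\<exists>F. finite F \<and> F \<subseteq> components (- E) \<and> (\<forall>I\<in>F. I \<subseteq> {l<..<r}) \<and>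
    measure lborel ({l<..<r} - \<Union>F) \<le> 3 * d"
proof -
  note gaps = gaps'[rule_format, OF conjI, OF _ conjI]
  have d: "0 < d" using gaps[of "{}"] by simp
  obtain V where V: "open V" "E \<subseteq> V" "emeasure lborel (V - E) < ennreal d"
    using outer_regular_lborel[of E d] E(1) d by auto
  have [measurable]: "E \<in> sets borel" "V \<in> sets borel" using E(1) V(1) by auto
  have Vd: "emeasure lborel V < ennreal d"
  proof -
    have "emeasure lborel V = emeasure lborel (E \<union> (V - E))" using V(2) by (simp add: Un_absorb1)
    also have "\<dots> \<le> emeasure lborel E + emeasure lborel (V - E)" by (rule emeasure_subadditive) auto
    finally show ?thesis using E(2) V(3) by simp
  qed
  define K where "K = {l + d..r - d} - V"
  have K: "compact K" unfolding K_def by (rule compact_diff) (use V in auto)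
  define \<C> where "\<C> = {I \<in> components (- E). I \<subseteq> {l<..<r}}"
  have "K \<subseteq> \<Union>\<C>"
  proof
    fix x assume x: "x \<in> K"
    then have "x \<in> - E" using V(2) by (auto simp: K_def)
    then obtain I where I: "I \<in> components (- E)" "x \<in> I" by (metis Union_components UnionE)
    moreover have "I \<subseteq> {l<..<r}"
      by (rule component_within_cell[OF gaps I]) (use x in \<open>auto simp: K_def\<close>)
    ultimately show "x \<in> \<Union>\<C>" by (auto simp: \<C>_def)
  qed
  moreover have "open I" if "I \<in> \<C>" for I
    using that E(1) open_components[of "- E" I] by (auto simp: \<C>_def)
  ultimately obtain F where F: "F \<subseteq> \<C>" "finite F" "K \<subseteq> \<Union>F"
    using compactE[OF K] by metis
  show ?thesis
  proof (intro exI[of _ F] conjI ballI)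
    show "finite F" by fact
    show "F \<subseteq> components (- E)" "\<And>I. I \<in> F \<Longrightarrow> I \<subseteq> {l<..<r}" using F(1) by (auto simp: \<C>_def)
    have mF: "\<Union>F \<in> sets borel" using F(1) \<open>\<And>I. I \<in> \<C> \<Longrightarrow> open I\<close> by (intro borel_open open_Union) auto
    have "{l<..<r} - \<Union>F \<subseteq> ({l..l + d} \<union> {r - d..r}) \<union> V" 
    proof
      fix x assume "x \<in> {l<..<r} - \<Union>F"
      moreover from this have "x \<notin> K" using F(3) by blast
      ultimately show "x \<in> ({l..l + d} \<union> {r - d..r}) \<union> V" by (auto simp: K_def)
    qed
    then have "emeasure lborel ({l<..<r} - \<Union>F) \<le> emeasure lborel (({l..l + d} \<union> {r - d..r}) \<union> V)"
      by (intro emeasure_mono) auto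
    also have "\<dots> \<le> (emeasure lborel {l..l + d} + emeasure lborel {r - d..r}) + emeasure lborel V"
      by (intro order_trans[OF emeasure_subadditive] add_mono emeasure_subadditive order_refl) auto
    also have "\<dots> \<le> ennreal d + ennreal d + ennreal d"
      using d Vd by (intro add_mono) auto
    also have "\<dots> = ennreal (3 * d)" using d by (simp flip: ennreal_plus)
    finally show "measure lborel ({l<..<r} - \<Union>F) \<le> 3 * d"
      using d by (simp add: measure_def enn2real_leI)
  qed
qed

text \<open>Porosity fails for every constant, so c may be chosen after the number of cells. The
  interval obtained may be of any type; passing to its interior keeps the length.\<close>

lemma not_porous_interval:
  assumes "\<not> porous E" "0 < c"
  obtains s L where "0 < L"
    "\<And>J. J \<subseteq> {s<..<s + L} \<Longrightarrow> is_interval J \<Longrightarrow> J \<inter> E = {} \<Longrightarrow> measure lborel J < c * L"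
proof -
  obtain I where I: "is_interval I" "bounded I" "measure lborel I > 0"
    and gaps: "\<And>J. J \<subseteq> I \<Longrightarrow> is_interval J \<Longrightarrow> J \<inter> E = {} \<Longrightarrow> measure lborel J < c * measure lborel I"
    using assms unfolding porous_def by (meson not_le)
  have "I \<noteq> {}" using I(3) by auto
  then obtain a b where ab: "a \<le> b" "{a<..<b} \<subseteq> I" "I \<subseteq> {a..b}"
    using bounded_interval_endpoints I by metis
  have m: "measure lborel I = b - a"
    by (rule measure_between[OF ab real_interval_borel_measurable[OF I(1)]])
  show thesis
  proof
    show "0 < b - a" using m I(3) by simp
    show "measure lborel J < c * (b - a)" if "J \<subseteq> {a<..<a + (b - a)}" "is_interval J" "J \<inter> E = {}" for J
      using gaps[of J] that ab(2) m by auto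
  qed
qed

section \<open>Cells of equal length and trigonometric sums\<close>

definition unit_kernel :: "real \<Rightarrow> complex" where
  "unit_kernel = inv_fourier (indicator {0<..<1})"

definition trig_sum :: "(nat \<Rightarrow> complex) \<Rightarrow> nat \<Rightarrow> real \<Rightarrow> complex" where
  "trig_sum a N y = (\<Sum>j<N. a j * cis (2 * pi * y) ^ j)"

lemma inv_fourier_indicator_Ioo:
  assumes "0 < l"
  shows "inv_fourier (indicator {u<..<u + l}) x = l * (cis (2 * pi * x * u) * unit_kernel (l * x))"
proof -
  have "inv_fourier (indicator {u<..<u + l}) x
      = l *\<^sub>R (LINT \<xi>|lborel. cis (2 * pi * x * (u + l * \<xi>)) * indicator {u<..<u + l} (u + l * \<xi>))"
    unfolding inv_fourier_def by (subst lborel_integral_real_affine[where c=l and t=u]) (use assms in auto)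
  also have "(\<lambda>\<xi>. cis (2 * pi * x * (u + l * \<xi>)) * indicator {u<..<u + l} (u + l * \<xi>))
      = (\<lambda>\<xi>. cis (2 * pi * x * u) * (cis (2 * pi * (l * x) * \<xi>) * indicator {0<..<1} \<xi>))"
  proof
    fix \<xi>
    have "indicator {u<..<u + l} (u + l * \<xi>) = (indicator {0<..<1} \<xi> :: complex)"
      using assms by (simp add: indicator_def zero_less_mult_iff)
    then show "cis (2 * pi * x * (u + l * \<xi>)) * indicator {u<..<u + l} (u + l * \<xi>)
      = cis (2 * pi * x * u) * (cis (2 * pi * (l * x) * \<xi>) * indicator {0<..<1} \<xi>)"
      by (simp add: cis_mult mult.assoc[symmetric]) (simp add: algebra_simps)
  qed
  finally show ?thesis
    by (simp add: unit_kernel_def inv_fourier_def scaleR_conv_of_real)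
qed

text \<open>Shifting a cell by j l multiplies its transform by the j-th power of one phase, so the
  values on the cells become coefficients of a trigonometric polynomial.\<close>

lemma inv_fourier_cells:
  assumes "0 < l"
  shows "inv_fourier (\<lambda>\<xi>. \<Sum>j<N. a j * indicator {s + real j * l<..<s + real j * l + l} \<xi>) x
    = l * cis (2 * pi * x * s) * (unit_kernel (l * x) * trig_sum a N (l * x))"
proof -
  have "inv_fourier (\<lambda>\<xi>. \<Sum>j<N. a j * indicator {s + real j * l<..<s + real j * l + l} \<xi>) x
     = (\<Sum>j<N. inv_fourier (\<lambda>\<xi>. a j * indicator {s + real j * l<..<s + real j * l + l} \<xi>) x)"
    by (intro inv_fourier_sum step_fun_integrable step_fun_cmult step_fun_indicator) (auto simp: is_interval_1)
  also have "\<dots> = (\<Sum>j<N. l * cis (2 * pi * x * s) * unit_kernel (l * x) * (a j * cis (2 * pi * (l * x)) ^ j))"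
  proof (intro sum.cong refl)
    fix j
    have "cis (2 * pi * x * (s + real j * l)) = cis (2 * pi * x * s) * cis (2 * pi * (l * x)) ^ j"
      unfolding Complex.DeMoivre cis_mult by (simp add: algebra_simps)
    then show "inv_fourier (\<lambda>\<xi>. a j * indicator {s + real j * l<..<s + real j * l + l} \<xi>) x
        = l * cis (2 * pi * x * s) * unit_kernel (l * x) * (a j * cis (2 * pi * (l * x)) ^ j)"
      unfolding inv_fourier_cmult inv_fourier_indicator_Ioo[OF assms] by simp
  qed
  finally show ?thesis
    by (simp add: trig_sum_def sum_distrib_left mult.assoc)
qed

lemma measurable_unit_kernel [measurable]: "unit_kernel \<in> borel_measurable borel"
  unfolding unit_kernel_def by (rule measurable_inv_fourier) auto

lemma measurable_trig_sum [measurable]: "trig_sum a N \<in> borel_measurable borel"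
  unfolding trig_sum_def cis_conv_exp by measurable

lemma Lp_integral_dilate:
  assumes [measurable]: "f \<in> borel_measurable borel" and c: "0 < c"
  shows "Lp_integral p (\<lambda>x. k * f (c * x)) = ennreal (cmod k powr p / c) * Lp_integral p f"
proof -
  have "Lp_integral p (\<lambda>x. k * f (c * x)) = ennreal (cmod k powr p) * Lp_integral p (\<lambda>x. f (c * x))"
    by (rule Lp_integral_cmult) measurable
  also have "Lp_integral p (\<lambda>x. f (c * x)) = ennreal (1 / c) * (ennreal c * Lp_integral p (\<lambda>x. f (c * x)))"
    using c by (simp add: mult.assoc[symmetric] flip: ennreal_mult)
  also have "ennreal c * Lp_integral p (\<lambda>x. f (c * x)) = Lp_integral p f"
    by (rule Lp_integral_scale[OF assms, symmetric])
  finally show ?thesis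
    using c by (simp add: mult.assoc[symmetric] flip: ennreal_mult)
qed

text \<open>A uniform error is not small in L^p over the whole line, so the limit is taken by Fatou:
  the positive part of |f| - 1 / (n + 1) lies below |\<open>\<Phi> n\<close>| and tends to
  |f|.\<close>

lemma Lp_integral_le_of_approx:
  assumes [measurable]: "f \<in> borel_measurable borel" "\<And>n. \<Phi> n \<in> borel_measurable borel"
    and p: "0 < p" and le: "\<And>n. Lp_integral p (\<Phi> n) \<le> K"
    and approx: "\<And>n y. cmod (f y) \<le> cmod (\<Phi> n y) + inverse (real (Suc n))"
  shows "Lp_integral p f \<le> K"
proof -
  define w where "w n y = ennreal (max 0 (cmod (f y) - inverse (real (Suc n))) powr p)" for n y
  have [measurable]: "w n \<in> borel_measurable borel" for n unfolding w_def by measurable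
  have lim: "(\<lambda>n. w n y) \<longlonglongrightarrow> ennreal (cmod (f y) powr p)" for y
  proof -
    have "(\<lambda>n. max 0 (cmod (f y) - inverse (real (Suc n)))) \<longlonglongrightarrow> max 0 (cmod (f y) - 0)"
      by (intro tendsto_intros LIMSEQ_inverse_real_of_nat)
    then have "(\<lambda>n. max 0 (cmod (f y) - inverse (real (Suc n))) powr p) \<longlonglongrightarrow> cmod (f y) powr p"
      by (intro tendsto_powr') (use p in auto)
    then show ?thesis unfolding w_def by (rule tendsto_ennrealI)
  qed
  have "Lp_integral p f = (\<integral>\<^sup>+y. liminf (\<lambda>n. w n y) \<partial>lborel)"
    unfolding Lp_integral_def using lim_imp_Liminf[OF _ lim] by simp
  also have "\<dots> \<le> liminf (\<lambda>n. \<integral>\<^sup>+y. w n y \<partial>lborel)"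
    by (rule nn_integral_liminf) simp
  also have "\<dots> \<le> liminf (\<lambda>n. K)"
  proof (intro Liminf_mono always_eventually allI)
    fix n
    have "(\<integral>\<^sup>+y. w n y \<partial>lborel) \<le> Lp_integral p (\<Phi> n)"
      unfolding Lp_integral_def w_def
      by (intro nn_integral_mono ennreal_leI powr_mono2) (use p approx[of _ n] in \<open>auto simp: algebra_simps\<close>)
    also have "\<dots> \<le> K" by (rule le)
    finally show "(\<integral>\<^sup>+y. w n y \<partial>lborel) \<le> K" .
  qed
  also have "\<dots> = K" by (simp add: Liminf_const)
  finally show ?thesis .
qed

text \<open>For each error 1 / (n + 1), an interval with relatively small gaps is cut into N cells,
  and flipping finitely many components imitates the signs e. With the cells rescaled to unit length
  the transforms are uniformly close, and \<open>Lp_integral_le_of_approx\<close> removes the error.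
  C is the constant of the multiplier bound, hence independent of N.\<close>

lemma unconditional_trig_sum:
  assumes E: "closed E" "emeasure lborel E = 0" "\<not> porous E"
    and p: "1 < p" and LP: "LP_property p E"
  shows "\<exists>C>0. \<forall>N a e. (\<forall>j. cmod (a j) = 1) \<and> (\<forall>j. e j = 1 \<or> e j = -1) \<longrightarrow>
      Lp_integral p (\<lambda>y. unit_kernel y * trig_sum (\<lambda>j. e j * a j) N y)
        \<le> ennreal C * Lp_integral p (\<lambda>y. unit_kernel y * trig_sum a N y)"
proof -
  obtain C where C: "0 < C" and mult': "\<forall>g F. step_fun g \<and> finite F \<and> F \<subseteq> components (- E) \<longrightarrow>
      Lp_integral p (inv_fourier (\<lambda>\<xi>. (1 - 2 * (\<Sum>I\<in>F. indicator I \<xi>)) * g \<xi>)) \<le> ennreal C * Lp_integral p (inv_fourier g)"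
    using LP_property_sign_multiplier[OF p LP] by (elim exE conjE)
  note mult = mult'[rule_format, OF conjI, OF _ conjI]
  have main: "Lp_integral p (\<lambda>y. unit_kernel y * trig_sum (\<lambda>j. e j * a j) N y)
        \<le> ennreal C * Lp_integral p (\<lambda>y. unit_kernel y * trig_sum a N y)" (is "Lp_integral p ?f \<le> ?K")
    if a: "\<And>j. cmod (a j) = 1" and e: "\<And>j. e j = 1 \<or> e j = -1" and N: "0 < N"
    for N and a e :: "nat \<Rightarrow> complex"
  proof -
    have "\<exists>\<Phi>. \<Phi> \<in> borel_measurable borel \<and> Lp_integral p \<Phi> \<le> ?K \<and> (\<forall>y. cmod (?f y) \<le> cmod (\<Phi> y) + inverse (real (Suc n)))" for n
    proof -
      \<comment> \<open>Chosen so that N cells, each with an error of size 2 on a set of measure at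
        most 3 c L, give an L^1 error of at most 6 N c L = l / (n + 1), where l = L / N.\<close>
      define c where "c = inverse (real (Suc n)) / (6 * real N * real N)"
      have c: "0 < c" using N by (simp add: c_def)
      obtain s L where L: "0 < L" and gaps: "\<And>J. J \<subseteq> {s<..<s + L} \<Longrightarrow> is_interval J \<Longrightarrow> J \<inter> E = {} \<Longrightarrow> measure lborel J < c * L"
        using not_porous_interval[OF E(3) c] by metis
      define l where "l = L / real N"
      have l: "0 < l" using L N by (simp add: l_def)
      define Q where "Q j = {s + real j * l<..<s + real j * l + l}" for j
      have Qsub: "Q j \<subseteq> {s<..<s + L}" if "j < N" for j
      proof -
        have "real j * l + l = real (Suc j) * l" by (simp add: algebra_simps)
        also have "\<dots> \<le> real N * l" using that l by (intro mult_right_mono) auto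
        also have "\<dots> = L" using N by (simp add: l_def)
        finally have "real j * l + l \<le> L" .
        moreover have "0 \<le> real j * l" using l by simp
        ultimately show ?thesis
          unfolding Q_def by (intro subsetI) (simp only: greaterThanLessThan_iff, linarith)
      qed
      have Qdisj: "i = j" if "\<xi> \<in> Q i" "\<xi> \<in> Q j" for i j \<xi>
      proof -
        have aux: "\<not> i < j" if "\<xi> \<in> Q i" "\<xi> \<in> Q j" for i j
        proof
          assume "i < j"
          then have "real (Suc i) * l \<le> real j * l" using l by (intro mult_right_mono) auto
          then show False using that by (simp add: Q_def algebra_simps)
        qed
        show ?thesis using aux[OF that] aux[OF that(2,1)] by simp
      qed
      have "\<exists>F. finite F \<and> F \<subseteq> components (- E) \<and> (\<forall>I\<in>F. I \<subseteq> Q j) \<and> measure lborel (Q j - \<Union>F) \<le> 3 * (c * L)"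
        if "j < N" for j
      proof -
        have "\<forall>J. J \<subseteq> Q j \<and> is_interval J \<and> J \<inter> E = {} \<longrightarrow> measure lborel J < c * L"
          using gaps Qsub[OF that] by blast
        then show ?thesis
          unfolding Q_def by (rule finite_components_fill_cell[OF E(1,2)])
      qed
      then obtain F where F: "\<And>j. j < N \<Longrightarrow> finite (F j)" "\<And>j. j < N \<Longrightarrow> F j \<subseteq> components (- E)"
          "\<And>j I. j < N \<Longrightarrow> I \<in> F j \<Longrightarrow> I \<subseteq> Q j" "\<And>j. j < N \<Longrightarrow> measure lborel (Q j - \<Union>(F j)) \<le> 3 * (c * L)"
        by metis
      \<comment> \<open>Only finitely many signs are flipped, so that the multiplied function stays a step function
        and hence its transform is known to lie in \<open>L\<^sup>p\<close> for every \<open>p > 1\<close>.\<close>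
      define B where "B = {j. j < N \<and> e j = -1}"
      define G where "G = (\<Union>j\<in>B. F j)"
      have G: "finite G" "G \<subseteq> components (- E)" using F by (auto simp: G_def B_def)
      have Gm: "\<Union>H \<in> sets borel" if "H \<subseteq> components (- E)" for H
      proof (intro borel_open open_Union ballI)
        fix I assume "I \<in> H"
        then have "I \<in> components (- E)" using that by blast
        then show "open I" using open_components E(1) open_Compl by blast
      qed
      define g where "g b \<xi> = (\<Sum>j<N. b j * indicator (Q j) \<xi>)" for b :: "nat \<Rightarrow> complex" and \<xi>
      have g: "step_fun (g b)" for b
        unfolding g_def by (intro step_fun_sum step_fun_cmult step_fun_indicator) (simp_all add: Q_def)
      have gQ: "g b \<xi> = b j" if "j < N" "\<xi> \<in> Q j" for b j \<xi>
      proof -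
        have "g b \<xi> = (\<Sum>i<N. if i = j then b j else 0)"
          unfolding g_def
        proof (intro sum.cong refl)
          fix i
          have "\<xi> \<in> Q i \<longleftrightarrow> i = j" using Qdisj that(2) by blast
          then show "b i * indicator (Q i) \<xi> = (if i = j then b j else 0)"
            using that(2) by auto
        qed
        then show ?thesis using that by simp
      qed
      define m :: "real \<Rightarrow> complex" where "m \<xi> = 1 - 2 * (\<Sum>I\<in>G. indicator I \<xi>)" for \<xi>
      have m_in: "m \<xi> = -1" if "\<xi> \<in> \<Union>G" for \<xi>
      proof -
        from that obtain I where I: "I \<in> G" "\<xi> \<in> I" by blast
        have "(\<Sum>I'\<in>G. indicator I' \<xi>) = (\<Sum>I'\<in>G. if I' = I then 1 else 0 :: complex)"
        proof (intro sum.cong refl)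
          fix I' assume "I' \<in> G"
          then have "\<xi> \<in> I' \<longleftrightarrow> I' = I"
            using components_nonoverlap[of I "- E" I'] I G(2) by blast
          then show "indicator I' \<xi> = (if I' = I then 1 else 0 :: complex)" by (auto simp: indicator_def)
        qed
        then show ?thesis using I G by (simp add: m_def)
      qed
      have m_out: "m \<xi> = 1" if "\<xi> \<notin> \<Union>G" for \<xi>
        using that by (auto simp: m_def intro!: sum.neutral)
      \<comment> \<open>The defect of the imitation. It is nonzero only in cells of B at points
        missed by the chosen components, where the multiplier is 1 instead of -1 and |D| =
        2.\<close>
      define D where "D \<xi> = m \<xi> * g a \<xi> - g (\<lambda>j. e j * a j) \<xi>" for \<xi>
      have D: "cmod (D \<xi>) \<le> (\<Sum>j<N. 2 * indicator (Q j - \<Union>(F j)) \<xi>)" for \<xi>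
      proof (cases "\<exists>j<N. \<xi> \<in> Q j")
        case False
        then have "g b \<xi> = 0" for b unfolding g_def by (intro sum.neutral) auto
        then have "D \<xi> = 0" by (simp add: D_def)
        then show ?thesis by (simp add: sum_nonneg)
      next
        case True
        then obtain j where j: "j < N" "\<xi> \<in> Q j" by blast
        have inG: "\<xi> \<in> \<Union>G \<longleftrightarrow> j \<in> B \<and> \<xi> \<in> \<Union>(F j)"
        proof
          assume "\<xi> \<in> \<Union>G"
          then obtain i I where i: "i \<in> B" "I \<in> F i" "\<xi> \<in> I" by (auto simp: G_def)
          then have "\<xi> \<in> Q i" using F(3)[of i I] by (auto simp: B_def)
          then have "i = j" using Qdisj j by blast
          then show "j \<in> B \<and> \<xi> \<in> \<Union>(F j)" using i by blast
        qed (auto simp: G_def)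
        have "cmod (D \<xi>) \<le> 2 * indicator (Q j - \<Union>(F j)) \<xi>"
        proof (cases "j \<in> B \<and> \<xi> \<notin> \<Union>(F j)")
          case True
          have "cmod (D \<xi>) = 2"
            using True j a[of j] m_out[of \<xi>] inG by (simp add: D_def gQ B_def norm_mult flip: mult_2)
          then show ?thesis using True j by simp
        next
          case False
          have "D \<xi> = 0"
          proof (cases "j \<in> B")
            case True
            then show ?thesis using False inG m_in[of \<xi>] j by (simp add: D_def gQ B_def)
          next
            case False
            then show ?thesis using inG m_out[of \<xi>] j e[of j] by (auto simp: D_def gQ B_def)
          qed
          then show ?thesis by simp
        qed
        also have "\<dots> \<le> (\<Sum>j<N. 2 * indicator (Q j - \<Union>(F j)) \<xi>)"
          using j by (intro member_le_sum) auto
        finally show ?thesis .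
      qed
      have mg: "step_fun (\<lambda>\<xi>. m \<xi> * g a \<xi>)"
      proof -
        have "step_fun (\<lambda>\<xi>. g a \<xi> + (-2) * (\<Sum>I\<in>G. indicator I \<xi> * g a \<xi>))"
          using G by (intro step_fun_add step_fun_cmult step_fun_sum g step_fun_indicator_mult) (auto intro: is_interval_component)
        also have "(\<lambda>\<xi>. g a \<xi> + (-2) * (\<Sum>I\<in>G. indicator I \<xi> * g a \<xi>)) = (\<lambda>\<xi>. m \<xi> * g a \<xi>)"
          by (auto simp: m_def left_diff_distrib sum_distrib_right mult.assoc)
        finally show ?thesis .
      qed
      have Dstep: "step_fun D"
        using step_fun_add[OF mg step_fun_cmult[OF g, of "-1"]] by (simp add: D_def[abs_def])
      have intD: "(LINT \<xi>|lborel. cmod (D \<xi>)) \<le> l * inverse (real (Suc n))"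
      proof -
        have bQ: "bounded (Q j - \<Union>(F j))" for j
          by (rule bounded_subset[of "Q j"]) (auto simp: Q_def)
        have mQ: "Q j - \<Union>(F j) \<in> sets borel" if "j < N" for j
          using Gm[OF F(2)[OF that]] by (auto simp: Q_def)
        have int: "integrable lborel (\<lambda>\<xi>. 2 * indicator (Q j - \<Union>(F j)) \<xi> :: real)" if "j < N" for j
          using emeasure_bounded_finite[OF bQ[of j]] mQ[OF that]
          by (intro integrable_mult_right integrable_real_indicator) auto
        have "(LINT \<xi>|lborel. cmod (D \<xi>)) \<le> (LINT \<xi>|lborel. (\<Sum>j<N. 2 * indicator (Q j - \<Union>(F j)) \<xi>))"
          using int by (intro integral_mono D integrable_norm step_fun_integrable Dstep Bochner_Integration.integrable_sum) auto
        also have "\<dots> = (\<Sum>j<N. (LINT \<xi>|lborel. 2 * indicator (Q j - \<Union>(F j)) \<xi>))"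
          using int by (intro Bochner_Integration.integral_sum) auto
        also have "\<dots> = (\<Sum>j<N. 2 * measure lborel (Q j - \<Union>(F j)))"
          using mQ by (intro sum.cong) auto
        also have "\<dots> \<le> (\<Sum>j<N. 6 * (c * L))"
        proof (intro sum_mono)
          fix j assume "j \<in> {..<N}"
          then show "2 * measure lborel (Q j - \<Union>(F j)) \<le> 6 * (c * L)" using F(4)[of j] by (simp add: mult.commute)
        qed
        also have "\<dots> = l * inverse (real (Suc n))"
          using N by (simp add: c_def l_def)
        finally show ?thesis .
      qed
      \<comment> \<open>This dilation brings the cells to length 1. Both sides of the multiplier
        bound acquire the same factor, so C is unchanged.\<close>
      define \<Phi> where "\<Phi> y = complex_of_real (1 / l) * inv_fourier (\<lambda>\<xi>. m \<xi> * g a \<xi>) ((1 / l) * y)" for y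
      have [measurable]: "inv_fourier (\<lambda>\<xi>. m \<xi> * g a \<xi>) \<in> borel_measurable borel" "inv_fourier (g b) \<in> borel_measurable borel" for b
        by (intro measurable_inv_fourier step_fun_measurable mg g)+
      \<comment> \<open>The position s of the interval enters only through a phase, which the
        modulus removes.\<close>
      have resc: "cmod (complex_of_real (1 / l) * inv_fourier (g b) ((1 / l) * y)) = cmod (unit_kernel y * trig_sum b N y)" for b y
        using l inv_fourier_cells[OF l, of b s N "(1 / l) * y"]
        by (simp add: g_def[abs_def] Q_def norm_mult norm_divide)
      have "Lp_integral p \<Phi> = ennreal (cmod (complex_of_real (1 / l)) powr p / (1 / l)) * Lp_integral p (inv_fourier (\<lambda>\<xi>. m \<xi> * g a \<xi>))"
        unfolding \<Phi>_def using l by (intro Lp_integral_dilate) auto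
      also have "\<dots> \<le> ennreal (cmod (complex_of_real (1 / l)) powr p / (1 / l)) * (ennreal C * Lp_integral p (inv_fourier (g a)))"
        unfolding m_def by (intro mult_left_mono mult g G) auto
      also have "\<dots> = ennreal C * (ennreal (cmod (complex_of_real (1 / l)) powr p / (1 / l)) * Lp_integral p (inv_fourier (g a)))"
        by (simp only: mult_ac)
      also have "ennreal (cmod (complex_of_real (1 / l)) powr p / (1 / l)) * Lp_integral p (inv_fourier (g a))
          = Lp_integral p (\<lambda>y. complex_of_real (1 / l) * inv_fourier (g a) ((1 / l) * y))"
        using l by (intro Lp_integral_dilate[symmetric]) auto
      also have "\<dots> = Lp_integral p (\<lambda>y. unit_kernel y * trig_sum a N y)"
        unfolding Lp_integral_def resc ..
      finally have "Lp_integral p \<Phi> \<le> ?K" .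
      moreover have "cmod (?f y) \<le> cmod (\<Phi> y) + inverse (real (Suc n))" for y
      proof -
        have "inv_fourier (\<lambda>\<xi>. m \<xi> * g a \<xi>) x = inv_fourier (g (\<lambda>j. e j * a j)) x + inv_fourier D x" for x
        proof -
          have "(\<lambda>\<xi>. m \<xi> * g a \<xi>) = (\<lambda>\<xi>. g (\<lambda>j. e j * a j) \<xi> + D \<xi>)" by (auto simp: D_def)
          then show ?thesis by (simp add: inv_fourier_add step_fun_integrable g Dstep)
        qed
        then have "complex_of_real (1 / l) * inv_fourier (g (\<lambda>j. e j * a j)) ((1 / l) * y)
            = \<Phi> y - complex_of_real (1 / l) * inv_fourier D ((1 / l) * y)"
          by (simp add: \<Phi>_def algebra_simps)
        then have "cmod (?f y) \<le> cmod (\<Phi> y) + cmod (complex_of_real (1 / l) * inv_fourier D ((1 / l) * y))"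
          unfolding resc[symmetric] by (metis norm_triangle_ineq4)
        \<comment> \<open>An L^1 error in frequency is a uniform error in y, and the factor 1 / l
          cancels the cell length.\<close>
        also have "cmod (complex_of_real (1 / l) * inv_fourier D ((1 / l) * y)) \<le> (1 / l) * (l * inverse (real (Suc n)))"
          unfolding norm_mult using l order_trans[OF norm_inv_fourier_le intD]
          by (intro mult_mono) (auto simp: norm_divide)
        also have "\<dots> = inverse (real (Suc n))" using l by simp
        finally show ?thesis by simp
      qed
      moreover have "\<Phi> \<in> borel_measurable borel" unfolding \<Phi>_def by measurable
      ultimately show ?thesis by blast
    qed
    then obtain \<Phi> where "\<And>n. \<Phi> n \<in> borel_measurable borel" "\<And>n. Lp_integral p (\<Phi> n) \<le> ?K"
      "\<And>n y. cmod (?f y) \<le> cmod (\<Phi> n y) + inverse (real (Suc n))" by metis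
    then show ?thesis
      using p by (intro Lp_integral_le_of_approx[of ?f \<Phi>]) auto
  qed
  show ?thesis
  proof (intro exI[of _ C] conjI allI impI)
    show "0 < C" by fact
    fix N :: nat and a e :: "nat \<Rightarrow> complex"
    assume "(\<forall>j. cmod (a j) = 1) \<and> (\<forall>j. e j = 1 \<or> e j = -1)"
    then show "Lp_integral p (\<lambda>y. unit_kernel y * trig_sum (\<lambda>j. e j * a j) N y)
        \<le> ennreal C * Lp_integral p (\<lambda>y. unit_kernel y * trig_sum a N y)"
      \<comment> \<open>For N = 0 both sums are empty and both sides vanish; \<open>main\<close>
        divides by N.\<close>
      using main[of a e N] by (cases "N = 0") (auto simp: trig_sum_def Lp_integral_def)
  qed
qed

section \<open>Rudin-Shapiro polynomials against the Dirichlet kernel\<close>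

lemma trig_sum_append:
  "trig_sum (\<lambda>j. if j < N then a j else b (j - N)) (N + M) y = trig_sum a N y + cis (2 * pi * y) ^ N * trig_sum b M y"
proof (induction M)
  case 0
  show ?case by (simp add: trig_sum_def)
next
  case (Suc M)
  then show ?case by (simp add: trig_sum_def algebra_simps power_add)
qed

text \<open>A pair P, Q of length N is replaced by P + z^N Q and P - z^N Q; since |z| = 1, the
  parallelogram law doubles the sum of squares at every point. The coefficients are signs at all
  indices, as \<open>unconditional_trig_sum\<close> requires.\<close>

lemma Rudin_Shapiro:
  "\<exists>a b :: nat \<Rightarrow> complex. (\<forall>j. a j = 1 \<or> a j = -1) \<and> (\<forall>j. b j = 1 \<or> b j = -1) \<and>
    (\<forall>y. (cmod (trig_sum a (2 ^ n) y))\<^sup>2 + (cmod (trig_sum b (2 ^ n) y))\<^sup>2 = 2 * 2 ^ n)"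
proof (induction n)
  case 0
  show ?case by (intro exI[of _ "\<lambda>_. 1"]) (simp add: trig_sum_def)
next
  case (Suc n)
  then obtain a b :: "nat \<Rightarrow> complex" where ab: "\<And>j. a j = 1 \<or> a j = -1" "\<And>j. b j = 1 \<or> b j = -1"
    and sq: "\<And>y. (cmod (trig_sum a (2 ^ n) y))\<^sup>2 + (cmod (trig_sum b (2 ^ n) y))\<^sup>2 = 2 * 2 ^ n" by metis
  define N :: nat where "N = 2 ^ n"
  let ?c = "\<lambda>s j. if j < N then a j else s * b (j - N)"
  have par: "(cmod (u + v))\<^sup>2 + (cmod (u - v))\<^sup>2 = 2 * ((cmod u)\<^sup>2 + (cmod v)\<^sup>2)" for u v
    unfolding cmod_power2 by (simp add: power2_eq_square algebra_simps)
  have smult: "trig_sum (\<lambda>j. s * b j) N y = s * trig_sum b N y" for s y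
    by (simp add: trig_sum_def sum_distrib_left mult.assoc)
  have "(cmod (trig_sum (?c 1) (N + N) y))\<^sup>2 + (cmod (trig_sum (?c (-1)) (N + N) y))\<^sup>2 = 2 * (2 * 2 ^ n)" for y
  proof -
    let ?v = "cis (2 * pi * y) ^ N * trig_sum b N y"
    have "trig_sum (?c 1) (N + N) y = trig_sum a N y + ?v" "trig_sum (?c (-1)) (N + N) y = trig_sum a N y - ?v"
      unfolding trig_sum_append[of N a "\<lambda>j. _ * b j"] smult by simp_all
    moreover have "cmod ?v = cmod (trig_sum b N y)" by (simp add: norm_mult norm_power)
    ultimately show ?thesis using sq[of y] by (simp add: par N_def)
  qed
  moreover have "N + N = 2 ^ Suc n" by (simp add: N_def)
  ultimately have "\<forall>y. (cmod (trig_sum (?c 1) (2 ^ Suc n) y))\<^sup>2 + (cmod (trig_sum (?c (-1)) (2 ^ Suc n) y))\<^sup>2 = 2 * 2 ^ Suc n"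
    by simp
  moreover have sign: "?c s j = 1 \<or> ?c s j = -1" if "s = 1 \<or> s = -1" for s j
    using ab(1)[of j] ab(2)[of "j - N"] that by auto
  ultimately show ?case
    by (intro exI[of _ "?c 1"] exI[of _ "?c (-1)"] conjI allI sign) simp_all
qed

text \<open>Up to the phase cis(pi y) this is sin(pi y) / (pi y); the form given here telescopes
  against a geometric sum.\<close>

lemma unit_kernel_nonzero_eq:
  assumes "y \<noteq> 0"
  shows "unit_kernel y = (cis (2 * pi * y) - 1) / (2 * pi * \<i> * y)"
  unfolding unit_kernel_def
  using assms by (subst inv_fourier_indicator_eq_Icc[of 0 1]) (auto simp: inv_fourier_indicator_Icc)

lemma unit_kernel_0: "unit_kernel 0 = 1"
proof -
  have "(LINT \<xi>|lborel. complex_of_real (indicator {0<..<1} (\<xi>::real))) = 1"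
    by (subst integral_complex_of_real) simp
  also have "(\<lambda>\<xi>. complex_of_real (indicator {0<..<1} (\<xi>::real))) = indicator {0<..<1}"
    by (auto simp: indicator_def)
  finally show ?thesis by (simp add: unit_kernel_def inv_fourier_def)
qed

text \<open>On the frequency side, N adjacent unit cells with coefficient 1 fill (0, N) up to
  endpoints. In the formula, the geometric sum turns the numerator z - 1 of the kernel into z^N -
  1.\<close>

lemma unit_kernel_mult_Dirichlet:
  "unit_kernel y * trig_sum (\<lambda>_. 1) N y = of_nat N * unit_kernel (real N * y)"
proof (cases "y = 0 \<or> N = 0")
  case True
  then show ?thesis by (auto simp: unit_kernel_0 trig_sum_def)
next
  case False
  let ?z = "cis (2 * pi * y)"
  have "(?z - 1) * trig_sum (\<lambda>_. 1) N y = ?z ^ N - 1"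
    by (simp add: trig_sum_def power_diff_1_eq)
  also have "?z ^ N = cis (2 * pi * (real N * y))"
    unfolding Complex.DeMoivre by (simp add: mult_ac)
  finally have "unit_kernel y * trig_sum (\<lambda>_. 1) N y = (cis (2 * pi * (real N * y)) - 1) / (2 * pi * \<i> * y)"
    using False by (simp add: unit_kernel_nonzero_eq)
  also have "\<dots> = of_nat N * unit_kernel (real N * y)"
    using False by (simp add: unit_kernel_nonzero_eq)
  finally show ?thesis .
qed

text \<open>Integrating |cis(t) - 1| <= |t| over the unit interval; this keeps the kernel away from
  0 near the origin.\<close>

lemma norm_unit_kernel_minus_1_le: "cmod (unit_kernel y - 1) \<le> 2 * pi * \<bar>y\<bar>"
proof -
  let ?g = "indicator {0<..<1} :: real \<Rightarrow> complex"
  have g: "integrable lborel ?g" by (rule integrable_indicator_bounded_interval) auto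
  have int: "integrable lborel (\<lambda>\<xi>. cis (2 * pi * y * \<xi>) * ?g \<xi> - cis (2 * pi * 0 * \<xi>) * ?g \<xi>)"
    by (intro Bochner_Integration.integrable_diff integrable_cis_mult g)
  have "unit_kernel y - 1 = unit_kernel y - unit_kernel 0" by (simp add: unit_kernel_0)
  also have "\<dots> = (LINT \<xi>|lborel. cis (2 * pi * y * \<xi>) * ?g \<xi> - cis (2 * pi * 0 * \<xi>) * ?g \<xi>)"
    unfolding unit_kernel_def inv_fourier_def
    by (intro Bochner_Integration.integral_diff[symmetric] integrable_cis_mult g)
  finally have "cmod (unit_kernel y - 1) \<le> (LINT \<xi>|lborel. cmod (cis (2 * pi * y * \<xi>) * ?g \<xi> - cis (2 * pi * 0 * \<xi>) * ?g \<xi>))"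
    by (simp only: integral_norm_bound)
  also have "\<dots> \<le> (LINT \<xi>|lborel. 2 * pi * \<bar>y\<bar> * indicator {0<..<1} (\<xi>::real))"
  proof (intro integral_mono integrable_norm int integrable_mult_right)
    show "integrable lborel (indicator {0<..<1} :: real \<Rightarrow> real)"
      by (intro integrable_real_indicator) auto
    fix \<xi> :: real
    show "cmod (cis (2 * pi * y * \<xi>) * ?g \<xi> - cis (2 * pi * 0 * \<xi>) * ?g \<xi>) \<le> 2 * pi * \<bar>y\<bar> * indicator {0<..<1} \<xi>"
    proof (cases "\<xi> \<in> {0<..<1}")
      case True
      have "cmod (cis (2 * pi * y * \<xi>) - 1) \<le> \<bar>2 * pi * y * \<xi>\<bar>"
        using iexp_approx1[of "2 * pi * y * \<xi>" 0] by (simp add: cis_conv_exp)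
      also have "\<dots> = 2 * pi * \<bar>y\<bar> * \<xi>" using True by (simp add: abs_mult)
      also have "\<dots> \<le> 2 * pi * \<bar>y\<bar>" using True by (intro mult_left_le) auto
      finally show ?thesis using True by simp
    qed simp
  qed
  also have "\<dots> = 2 * pi * \<bar>y\<bar>" by simp
  finally show ?thesis .
qed

lemma Lp_integral_unit_kernel_pos: "0 < Lp_integral p unit_kernel"
proof -
  \<comment> \<open>On [0, 1/16] one has 2 pi y <= 1/2 because pi < 4, so the modulus of the kernel
    lies between 1/2 and 3/2. The minimum covers exponents p of either sign.\<close>
  have "0 < ennreal (min ((1/2) powr p) ((3/2) powr p)) * emeasure lborel {0..1/16::real}"
    by (simp add: ennreal_zero_less_mult_iff)
  also have "\<dots> = (\<integral>\<^sup>+y. ennreal (min ((1/2) powr p) ((3/2) powr p)) * indicator {0..1/16} (y::real) \<partial>lborel)"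
    by (subst nn_integral_cmult_indicator) auto
  also have "\<dots> \<le> Lp_integral p unit_kernel"
    unfolding Lp_integral_def
  proof (intro nn_integral_mono)
    fix y :: real
    show "ennreal (min ((1/2) powr p) ((3/2) powr p)) * indicator {0..1/16} y \<le> ennreal (cmod (unit_kernel y) powr p)"
    proof (cases "y \<in> {0..1/16}")
      case True
      have "2 * pi * \<bar>y\<bar> \<le> 2 * 4 * (1/16)"
        using True pi_less_4 by (intro mult_mono) auto
      then have d: "cmod (unit_kernel y - 1) \<le> 1/2" using norm_unit_kernel_minus_1_le[of y] by simp
      have b: "1/2 \<le> cmod (unit_kernel y)" "cmod (unit_kernel y) \<le> 3/2"
        using d norm_triangle_ineq2[of 1 "1 - unit_kernel y"] norm_triangle_ineq[of 1 "unit_kernel y - 1"]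
        by (simp_all add: norm_minus_commute)
      have "min ((1/2) powr p) ((3/2) powr p) \<le> cmod (unit_kernel y) powr p"
      proof (cases "0 \<le> p")
        case True
        then have "(1/2) powr p \<le> cmod (unit_kernel y) powr p" using b by (intro powr_mono2) auto
        then show ?thesis by simp
      next
        case False
        then have "(3/2) powr p \<le> cmod (unit_kernel y) powr p" using b by (intro powr_mono2') auto
        then show ?thesis by simp
      qed
      then show ?thesis using True by (simp add: ennreal_leI)
    qed simp
  qed
  finally show ?thesis .
qed

text \<open>The height N contributes N^p and the dilation by N contributes 1 / N.\<close>

lemma Lp_integral_unit_kernel_mult_Dirichlet:
  assumes "0 < N"
  shows "Lp_integral p (\<lambda>y. unit_kernel y * trig_sum (\<lambda>_. 1) N y) = ennreal (real N powr (p - 1)) * Lp_integral p unit_kernel"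
  unfolding unit_kernel_mult_Dirichlet using assms
  by (subst Lp_integral_dilate) (auto simp: powr_diff)

text \<open>Applied to the Rudin-Shapiro pair, this yields the lower bound needed for \<open>p < 2\<close> without
  any orthogonality argument.\<close>

lemma powr_add_powr_ge_of_sum_squares:
  fixes u v m p :: real
  assumes "0 \<le> u" "0 \<le> v" "0 < m" "u\<^sup>2 + v\<^sup>2 = m" "p \<le> 2"
  shows "m powr (p / 2) \<le> u powr p + v powr p"
proof -
  \<comment> \<open>The shares u^2 / m and v^2 / m lie in [0, 1] and add up to 1; raising a positive
    share to the power p / 2 <= 1 does not decrease it.\<close>
  have aux: "m powr (p / 2) * (w\<^sup>2 / m) \<le> w powr p" if w: "0 \<le> w" "w\<^sup>2 \<le> m" for w
  proof (cases "w = 0")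
    case False
    then have w0: "0 < w" using w by simp
    have "w\<^sup>2 / m \<le> (w\<^sup>2 / m) powr (p / 2)"
      using powr_mono'[of "p / 2" 1 "w\<^sup>2 / m"] w w0 assms by simp
    also have "\<dots> = w powr p / m powr (p / 2)"
    proof -
      have "(w\<^sup>2) powr (p / 2) = w powr p"
        using w0 powr_powr[of w 2 "p / 2"] by simp
      then show ?thesis using assms(3) by (simp add: powr_divide)
    qed
    finally show ?thesis
      using mult_left_mono[of "w\<^sup>2 / m" "w powr p / m powr (p / 2)" "m powr (p / 2)"] assms(3) by simp
  qed simp
  have "u\<^sup>2 / m + v\<^sup>2 / m = 1"
    using assms(3,4) by (simp add: add_divide_distrib[symmetric])
  then have "m powr (p / 2) = m powr (p / 2) * (u\<^sup>2 / m) + m powr (p / 2) * (v\<^sup>2 / m)"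
    by (metis distrib_left mult.right_neutral)
  also have "\<dots> \<le> u powr p + v powr p"
  proof (intro add_mono aux assms(1,2))
    show "u\<^sup>2 \<le> m" "v\<^sup>2 \<le> m"
      using assms(4) zero_le_power2[of u] zero_le_power2[of v] by linarith+
  qed
  finally show ?thesis .
qed

text \<open>Rudin-Shapiro pairs have length 2^n, so powers of N are compared along powers of 2; a
  positive exponent would give unbounded geometric growth.\<close>

lemma bounded_pow2_powr_imp_nonpos:
  fixes \<gamma> K :: real
  assumes "\<And>n::nat. (2 ^ n) powr \<gamma> \<le> K"
  shows "\<gamma> \<le> 0"
proof (rule ccontr)
  assume "\<not> \<gamma> \<le> 0"
  then have "1 < 2 powr \<gamma>" by simp
  then obtain n where "K < (2 powr \<gamma>) ^ n" using real_arch_pow by blast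
  also have "(2 powr \<gamma>) ^ n = (2 ^ n) powr \<gamma>"
    by (simp add: powr_powr mult.commute flip: powr_realpow)
  finally show False using assms[of n] by simp
qed

section \<open>Comparison of powers of N for p above and below 2\<close>

theorem theorem1:
  fixes E :: "real set" and p :: real
  assumes "closed E"
    and "emeasure lborel E = 0"
    and "1 < p" and "p \<noteq> 2"
    and "LP_property p E"
  shows "porous E"
proof (rule ccontr)
  assume "\<not> porous E"
  from unconditional_trig_sum[OF assms(1,2) this assms(3,5)] obtain C where C: "0 < C"
    and unc: "\<forall>N a e. (\<forall>j. cmod (a j) = 1) \<and> (\<forall>j. e j = 1 \<or> e j = -1) \<longrightarrow>
      Lp_integral p (\<lambda>y. unit_kernel y * trig_sum (\<lambda>j. e j * a j) N y)
        \<le> ennreal C * Lp_integral p (\<lambda>y. unit_kernel y * trig_sum a N y)"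
    by (elim exE conjE)
  have unitary: "\<forall>j. cmod (a j) = 1" if "\<forall>j. a j = 1 \<or> a j = -1" for a :: "nat \<Rightarrow> complex"
    using that by (metis norm_minus_cancel norm_one)
  have "unit_kernel \<in> Lp p"
    unfolding unit_kernel_def using assms(3) by (intro inv_fourier_mem_Lp step_fun_indicator) auto
  then obtain \<alpha> where \<alpha>: "Lp_integral p unit_kernel = ennreal \<alpha>" "0 < \<alpha>"
    using Lp_integral_unit_kernel_pos[of p] by (cases "Lp_integral p unit_kernel") (auto simp: mem_Lp_iff)
  show False
  proof (cases "2 < p")
    case True
    \<comment> \<open>For p > 2 the coefficients are Rudin-Shapiro signs a and the flips are a
      again, so the Dirichlet kernel appears on the left. This gives N^(p - 1) <= C (2 N)^(p / 2),
      since |P| <= sqrt(2 N) on the right.\<close>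
    have "(2 ^ n) powr (p / 2 - 1) \<le> C * 2 powr (p / 2)" for n
    proof -
      define N :: nat where "N = 2 ^ n"
      have N: "0 < N" "real N = 2 ^ n" by (simp_all add: N_def)
      obtain a b :: "nat \<Rightarrow> complex" where a: "\<forall>j. a j = 1 \<or> a j = -1"
        and sq: "\<And>y. (cmod (trig_sum a N y))\<^sup>2 + (cmod (trig_sum b N y))\<^sup>2 = 2 * N"
        using Rudin_Shapiro[of n] unfolding N_def by auto
      have aa: "(\<lambda>j. a j * a j) = (\<lambda>_. 1)"
      proof
        fix j
        show "a j * a j = 1" using a[rule_format, of j] by auto
      qed
      have "ennreal (real N powr (p - 1)) * ennreal \<alpha> \<le> ennreal C * Lp_integral p (\<lambda>y. unit_kernel y * trig_sum a N y)"
        using unc[rule_format, of a a N] a unitary[OF a] unfolding aa Lp_integral_unit_kernel_mult_Dirichlet[OF N(1)] \<alpha> by blast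
      also have "Lp_integral p (\<lambda>y. unit_kernel y * trig_sum a N y) \<le> Lp_integral p (\<lambda>y. complex_of_real (sqrt (2 * N)) * unit_kernel y)"
      proof (intro Lp_integral_mono)
        fix y
        have "(cmod (trig_sum a N y))\<^sup>2 \<le> 2 * N" using sq[of y] zero_le_power2[of "cmod (trig_sum b N y)"] by linarith
        then have "cmod (trig_sum a N y) \<le> sqrt (2 * N)" by (rule real_le_rsqrt)
        from mult_left_mono[OF this norm_ge_zero[of "unit_kernel y"]]
        show "cmod (unit_kernel y * trig_sum a N y) \<le> cmod (complex_of_real (sqrt (2 * N)) * unit_kernel y)"
          by (simp add: norm_mult mult.commute)
      qed (use assms in simp)
      also have "Lp_integral p (\<lambda>y. complex_of_real (sqrt (2 * N)) * unit_kernel y) = ennreal (sqrt (2 * N) powr p) * ennreal \<alpha>"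
        by (subst Lp_integral_cmult) (auto simp: \<alpha>)
      finally have "ennreal (real N powr (p - 1) * \<alpha>) \<le> ennreal (C * (sqrt (2 * N) powr p * \<alpha>))"
        using C \<alpha>(2) by (simp add: ennreal_mult mult_left_mono)
      then have "real N powr (p - 1) \<le> C * sqrt (2 * N) powr p"
        using C \<alpha>(2) by (simp add: ennreal_le_iff)
      also have "sqrt (2 * N) powr p = 2 powr (p / 2) * real N powr (p / 2)"
        by (simp add: powr_mult powr_powr flip: powr_half_sqrt)
      finally have "real N powr (p - 1) / real N powr (p / 2) \<le> C * 2 powr (p / 2)"
        using N(1) by (simp add: field_simps)
      moreover have "real N powr (p - 1) / real N powr (p / 2) = real N powr (p / 2 - 1)"
        by (simp flip: powr_diff)
      ultimately show ?thesis by (simp add: N)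
    qed
    from bounded_pow2_powr_imp_nonpos[OF this] True show False by simp
  next
    case False
    \<comment> \<open>For p < 2 the roles are exchanged: the coefficients are 1 and the flips are a
      and b in turn. The two upper bounds add up to 2 C N^(p - 1) \<alpha>, while the pointwise
      lower bound for the pair gives at least (2 N)^(p / 2) \<alpha>.\<close>
    have "(2 ^ n) powr (1 - p / 2) \<le> 2 * C / 2 powr (p / 2)" for n
    proof -
      define N :: nat where "N = 2 ^ n"
      have N: "0 < N" "real N = 2 ^ n" by (simp_all add: N_def)
      obtain a b :: "nat \<Rightarrow> complex" where ab: "\<forall>j. a j = 1 \<or> a j = -1" "\<forall>j. b j = 1 \<or> b j = -1"
        and sq: "\<And>y. (cmod (trig_sum a N y))\<^sup>2 + (cmod (trig_sum b N y))\<^sup>2 = 2 * N"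
        using Rudin_Shapiro[of n] unfolding N_def by auto
      have le: "Lp_integral p (\<lambda>y. unit_kernel y * trig_sum e N y) \<le> ennreal (C * (real N powr (p - 1) * \<alpha>))"
        if e: "\<forall>j. e j = 1 \<or> e j = -1" for e
        using unc[rule_format, of "\<lambda>_. 1" e N] e C \<alpha>(2)
        by (simp add: Lp_integral_unit_kernel_mult_Dirichlet[OF N(1)] \<alpha>(1) ennreal_mult)
      have "ennreal ((2 * N) powr (p / 2) * \<alpha>) = (\<integral>\<^sup>+y. ennreal ((2 * N) powr (p / 2)) * ennreal (cmod (unit_kernel y) powr p) \<partial>lborel)"
        using \<alpha> by (subst nn_integral_cmult) (auto simp: ennreal_mult Lp_integral_def)
      also have "\<dots> \<le> (\<integral>\<^sup>+y. ennreal (cmod (unit_kernel y * trig_sum a N y) powr p) + ennreal (cmod (unit_kernel y * trig_sum b N y) powr p) \<partial>lborel)"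
      proof (intro nn_integral_mono)
        fix y
        have "(2 * N) powr (p / 2) \<le> cmod (trig_sum a N y) powr p + cmod (trig_sum b N y) powr p"
          by (rule powr_add_powr_ge_of_sum_squares) (use sq[of y] N False in auto)
        from mult_right_mono[OF this powr_ge_zero[of "cmod (unit_kernel y)" p]]
        show "ennreal ((2 * N) powr (p / 2)) * ennreal (cmod (unit_kernel y) powr p)
            \<le> ennreal (cmod (unit_kernel y * trig_sum a N y) powr p) + ennreal (cmod (unit_kernel y * trig_sum b N y) powr p)"
          by (simp add: norm_mult powr_mult algebra_simps flip: ennreal_plus ennreal_mult)
      qed
      also have "\<dots> = Lp_integral p (\<lambda>y. unit_kernel y * trig_sum a N y) + Lp_integral p (\<lambda>y. unit_kernel y * trig_sum b N y)"
        unfolding Lp_integral_def by (rule nn_integral_add) auto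
      also have "\<dots> \<le> ennreal (C * (real N powr (p - 1) * \<alpha>)) + ennreal (C * (real N powr (p - 1) * \<alpha>))"
        by (intro add_mono le ab)
      also have "\<dots> = ennreal (2 * C * real N powr (p - 1) * \<alpha>)"
        using C \<alpha>(2) by (simp flip: ennreal_plus)
      finally have "(2 * N) powr (p / 2) * \<alpha> \<le> (2 * C * real N powr (p - 1)) * \<alpha>"
        using C \<alpha>(2) by (simp add: ennreal_le_iff)
      then have "2 powr (p / 2) * real N powr (p / 2) \<le> 2 * C * real N powr (p - 1)"
        using \<alpha>(2) by (simp add: powr_mult)
      then have "real N powr (p / 2) / real N powr (p - 1) \<le> 2 * C / 2 powr (p / 2)"
        using N(1) by (simp add: field_simps)
      moreover have "real N powr (p / 2) / real N powr (p - 1) = real N powr (1 - p / 2)"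
        by (simp flip: powr_diff)
      ultimately show ?thesis by (simp add: N)
    qed
    from bounded_pow2_powr_imp_nonpos[OF this] False assms(4) show False by simp
  qed
qed

end
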